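(* Let $F(z)=\sum_{n\ge 0} a_n z^n$, where $a_n$ is the number of permutations of length $n$ that avoid both $2413$ and $3412$ (so $a_0=1$). Then $F(z)$ is algebraic of degree $3$ over $\mathbb{Q}(z)$, and its minimal polynomial (in the variable $F$) is $$z^4F^3 + (5z^3-11z^2)F^2 + (3z^2+10z-1)F - 9z + 1.$$ That is, $z^4F(z)^3 + (5z^3-11z^2)F(z)^2 + (3z^2+10z-1)F(z) - 9z + 1=0$, and this polynomial is irreducible over $\mathbb{Q}(z)$.
   Context: A permutation $\pi=\pi(1)\cdots\pi(n)$ contains a permutation $\sigma=\sigma(1)\cdots\sigma(k)$ if there are indices $i_1<\cdots<i_k$ such that for all $a,b$, $\pi(i_a)<\pi(i_b)$ if and only if $\sigma(a)<\sigma(b)$; otherwise $\pi$ avoids $\sigma$. The set of all permutations (of all lengths, including the empty permutation of length $0$) avoiding both $2413$ and $3412$ is the permutation class denoted $\operatorname{Av}(2413,3412)$, and $F(z)$ is its generating function by length. A minimal polynomial of an algebraic power series in $z$ is understood up to multiplication by a nonzero element of $\mathbb{Q}(z)$. *)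

theory Defs
  imports
    "HOL-Computational_Algebra.Computational_Algebra"
    "HOL-Combinatorics.Combinatorics"
begin

section \<open>Permutation classes\<close>

text \<open>
  A permutation of length \<open>n\<close> is given in one-line notation, as a list that enumerates
  \<open>{1..n}\<close> without repetition. List positions count from \<open>0\<close>.
\<close>

definition is_perm :: "nat list \<Rightarrow> bool" where
  "is_perm p \<longleftrightarrow> p \<in> permutations_of_set {1..length p}"

definition contains :: "nat list \<Rightarrow> nat list \<Rightarrow> bool" where
  "contains p s \<longleftrightarrow>
     (\<exists>i :: nat \<Rightarrow> nat. strict_mono_on {..<length s} i \<and> i ` {..<length s} \<subseteq> {..<length p} \<and>
        (\<forall>a<length s. \<forall>b<length s. p ! i a < p ! i b \<longleftrightarrow> s ! a < s ! b))"

abbreviation avoids :: "nat list \<Rightarrow> nat list \<Rightarrow> bool" where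
  "avoids p s \<equiv> \<not> contains p s"

definition Av :: "nat list set \<Rightarrow> nat list set" where
  "Av B = {p. is_perm p \<and> (\<forall>s\<in>B. avoids p s)}"

definition class_gf :: "nat list set \<Rightarrow> rat fps" where
  "class_gf C = Abs_fps (\<lambda>n. of_nat (card {p \<in> C. length p = n}))"


section \<open>Algebraic series over the field of rational functions\<close>

text \<open>
  The field \<open>Q(z)\<close> is \<open>rat poly fract\<close>; it embeds into the field \<open>rat fls\<close> of formal Laurent
  series, which also contains the formal power series.
\<close>

definition poly_to_fls :: "rat poly \<Rightarrow> rat fls" where
  "poly_to_fls p = fps_to_fls (fps_of_poly p)"

lemma poly_to_fls_simps [simp]:
  "poly_to_fls 0 = 0" "poly_to_fls 1 = 1"
  "poly_to_fls (p + q) = poly_to_fls p + poly_to_fls q"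
  "poly_to_fls (p * q) = poly_to_fls p * poly_to_fls q"
  "poly_to_fls p = poly_to_fls q \<longleftrightarrow> p = q"
  by (simp_all add: poly_to_fls_def fps_of_poly_add fps_of_poly_mult fls_times_fps_to_fls
        fps_to_fls_eq_iff)

lemma poly_to_fls_eq_0_iff [simp]: "poly_to_fls p = 0 \<longleftrightarrow> p = 0"
  using poly_to_fls_simps(5)[of p 0] by (simp del: poly_to_fls_simps(5))

definition ratfun_to_fls :: "rat poly fract \<Rightarrow> rat fls" where
  "ratfun_to_fls r =
     (THE x. \<exists>p q. q \<noteq> 0 \<and> r = Fract p q \<and> x = poly_to_fls p / poly_to_fls q)"

lemma ratfun_to_fls_Fract:
  assumes "q \<noteq> 0"
  shows "ratfun_to_fls (Fract p q) = poly_to_fls p / poly_to_fls q"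
  unfolding ratfun_to_fls_def
proof (rule the_equality)
  show "\<exists>a b. b \<noteq> 0 \<and> Fract p q = Fract a b \<and>
          poly_to_fls p / poly_to_fls q = poly_to_fls a / poly_to_fls b"
    using assms by blast
next
  fix x
  assume "\<exists>a b. b \<noteq> 0 \<and> Fract p q = Fract a b \<and> x = poly_to_fls a / poly_to_fls b"
  then obtain a b where ab: "b \<noteq> 0" "p * b = a * q" "x = poly_to_fls a / poly_to_fls b"
    using assms by (auto simp: eq_fract)
  hence "poly_to_fls p * poly_to_fls b = poly_to_fls a * poly_to_fls q"
    by (simp flip: poly_to_fls_simps(4))
  with ab assms show "x = poly_to_fls p / poly_to_fls q"
    by (simp add: frac_eq_eq)
qed

lemma ratfun_to_fls_0 [simp]: "ratfun_to_fls 0 = 0"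
  by (simp add: Zero_fract_def ratfun_to_fls_Fract)

lemma ratfun_to_fls_1 [simp]: "ratfun_to_fls 1 = 1"
  by (simp add: One_fract_def ratfun_to_fls_Fract)

lemma ratfun_to_fls_add: "ratfun_to_fls (r + s) = ratfun_to_fls r + ratfun_to_fls s"
  by (cases r; cases s) (simp add: ratfun_to_fls_Fract add_frac_eq mult.commute)

lemma ratfun_to_fls_mult: "ratfun_to_fls (r * s) = ratfun_to_fls r * ratfun_to_fls s"
  by (cases r; cases s) (simp add: ratfun_to_fls_Fract)

lemma ratfun_to_fls_eq_0_iff [simp]: "ratfun_to_fls r = 0 \<longleftrightarrow> r = 0"
  by (cases r) (simp add: ratfun_to_fls_Fract Zero_fract_def eq_fract)

text \<open>Evaluation at \<open>f\<close> of a polynomial with coefficients in \<open>Q(z)\<close>.\<close>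

definition eval_at :: "rat poly fract poly \<Rightarrow> rat fps \<Rightarrow> rat fls" where
  "eval_at P f = poly (map_poly ratfun_to_fls P) (fps_to_fls f)"

definition algebraic_fps :: "rat fps \<Rightarrow> bool" where
  "algebraic_fps f \<longleftrightarrow> (\<exists>P. P \<noteq> 0 \<and> eval_at P f = 0)"

text \<open>
  Minimal polynomials need not be monic, so they are determined up to a nonzero factor
  from \<open>Q(z)\<close>.
\<close>

definition is_minimal_poly :: "rat poly fract poly \<Rightarrow> rat fps \<Rightarrow> bool" where
  "is_minimal_poly P f \<longleftrightarrow>
     P \<noteq> 0 \<and> eval_at P f = 0 \<and> (\<forall>Q. Q \<noteq> 0 \<and> eval_at Q f = 0 \<longrightarrow> degree P \<le> degree Q)"

text \<open>Only meaningful for algebraic \<open>f\<close>.\<close>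

definition algebraic_degree :: "rat fps \<Rightarrow> nat" where
  "algebraic_degree f = (LEAST d. \<exists>P. P \<noteq> 0 \<and> eval_at P f = 0 \<and> degree P = d)"

definition Z :: "rat poly fract" where
  "Z = to_fract [:0, 1:]"

end

theory Submission
  imports Defs "HOL-Library.Sublist"
begin

text \<open>
  Avoiding 2413 and 3412 means having no entries \<open>a b c d\<close>, in this order, with
  \<open>c < a, d\<close> and \<open>a, d < b\<close>. Splitting at the maximum, a nonempty avoider of length \<open>n\<close> is
  uniquely \<open>A n B D\<close> where the entries of \<open>B\<close> exceed those of \<open>A\<close> and \<open>D\<close>, \<open>D\<close> is decreasing,
  both \<open>B\<close> and \<open>A D\<close> are avoiders up to relabelling, and the maximum of \<open>A D\<close> is not in \<open>D\<close>.
  Counting pairs \<open>(A, D)\<close> with \<open>z\<close> for the total length and \<open>u\<close> for the length of \<open>D\<close> gives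
  a series \<open>P(u)\<close> with
  \<open>z (1 - u) P(u)\<^sup>2 - (1 - z u) (z F + 1 - u) P(u) + (1 - z u) (F - u) = 0\<close>.
  By the quadratic method, a power series \<open>U\<close> at which the \<open>P\<close>-derivative of the left-hand side
  vanishes is a double root of the discriminant with respect to \<open>P\<close>, which is
  \<open>1 - z u\<close> times a cubic polynomial in \<open>u\<close>. The discriminant of that cubic therefore vanishes, and it
  is \<open>16 (1 - z) (1 - z F)\<^sup>2\<close> times the claimed polynomial, up to powers of \<open>z\<close>.
  The minimal polynomial is irreducible since at \<open>z = -1\<close> it becomes the Eisenstein polynomial
  \<open>F\<^sup>3 - 16 F\<^sup>2 - 8 F + 10\<close>.
\<close>

section \<open>Weighted generating functions\<close>

lemma fps_X_power_dvd_iff: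
  fixes f :: "'a::comm_ring_1 fps"
  shows "fps_X ^ n dvd f \<longleftrightarrow> (\<forall>i<n. f $ i = 0)"
proof
  assume "\<forall>i<n. f $ i = 0"
  hence "f = fps_X ^ n * fps_shift n f"
    by (intro fps_ext) (auto simp: fps_X_power_mult_nth)
  thus "fps_X ^ n dvd f" by (metis dvd_triv_left)
qed (auto simp: fps_X_power_mult_nth elim!: dvdE)

lemma fps_eq_0_if_X_powers_dvd:
  fixes f :: "'a::comm_ring_1 fps"
  assumes "\<And>n. fps_X ^ n dvd f"
  shows "f = 0"
  using assms unfolding fps_X_power_dvd_iff by (intro fps_ext) auto

text \<open>Banach's fixed point theorem in the z-adic metric: \<open>fps_X ^ n dvd a - b\<close>
  says that \<open>a\<close> and \<open>b\<close> agree in their first \<open>n\<close>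
  coefficients, and \<open>f\<close> gains one coefficient of agreement.\<close>

lemma fps_fixpoint:
  fixes f :: "'a::comm_ring_1 fps \<Rightarrow> 'a fps"
  assumes contr: "\<And>a b n. fps_X ^ n dvd a - b \<Longrightarrow> fps_X ^ Suc n dvd f a - f b"
  obtains v where "f v = v"
proof
  define s where "s n = (f ^^ n) 0" for n
  \<comment> \<open>The iterates from \<open>s (Suc n)\<close> on share coefficient
    \<open>n\<close>, so this diagonal is their limit.\<close>
  define v where "v = Abs_fps (\<lambda>n. s (Suc n) $ n)"
  have s: "fps_X ^ n dvd s (n + k) - s n" for n k
    by (induction n) (use contr in \<open>auto simp: s_def\<close>)
  have v: "fps_X ^ n dvd v - s n" for n
    unfolding fps_X_power_dvd_iff
  proof (intro allI impI)
    fix i assume "i < n"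
    hence "fps_X ^ Suc i dvd s n - s (Suc i)"
      using s[of "Suc i" "n - Suc i"] by simp
    thus "(v - s n) $ i = 0"
      unfolding fps_X_power_dvd_iff by (auto simp: v_def)
  qed
  have "fps_X ^ n dvd f v - v" for n
  proof -
    have "s (Suc n) = f (s n)" by (simp add: s_def)
    hence "fps_X ^ Suc n dvd (f v - f (s n)) - (v - f (s n))"
      using dvd_diff[OF contr[OF v[of n]] v[of "Suc n"]] by (simp only:)
    thus ?thesis unfolding fps_X_power_dvd_iff by auto
  qed
  hence "f v - v = 0" by (rule fps_eq_0_if_X_powers_dvd)
  thus "f v = v" by simp
qed

text \<open>
  The sum of \<open>z ^ sz s * wt s\<close> over \<open>s \<in> X\<close>, formed coefficient by coefficient: objects of size
  greater than \<open>N\<close> do not affect the coefficient of \<open>z ^ N\<close>. Marking variables enter as power series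
  in the weight, so that no second formal variable is needed. Meaningful only if \<open>X\<close> has finitely
  many objects of each size.
\<close>

definition gf :: "'a set \<Rightarrow> ('a \<Rightarrow> nat) \<Rightarrow> ('a \<Rightarrow> 'b::comm_ring_1 fps) \<Rightarrow> 'b fps" where
  "gf X sz wt = Abs_fps (\<lambda>N. (\<Sum>s | s \<in> X \<and> sz s \<le> N. fps_X ^ sz s * wt s) $ N)"

definition locally_finite :: "'a set \<Rightarrow> ('a \<Rightarrow> nat) \<Rightarrow> bool" where
  "locally_finite X sz \<longleftrightarrow> (\<forall>N. finite {s \<in> X. sz s \<le> N})"

lemma locally_finiteD: "locally_finite X sz \<Longrightarrow> finite {s \<in> X. sz s \<le> N}"
  by (simp add: locally_finite_def)

lemma locally_finite_subset: "locally_finite Y sz \<Longrightarrow> X \<subseteq> Y \<Longrightarrow> locally_finite X sz"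
  unfolding locally_finite_def
proof
  fix N assume "\<forall>N. finite {s \<in> Y. sz s \<le> N}" "X \<subseteq> Y"
  moreover from this have "{s \<in> X. sz s \<le> N} \<subseteq> {s \<in> Y. sz s \<le> N}" by blast
  ultimately show "finite {s \<in> X. sz s \<le> N}" using finite_subset by blast
qed

lemma locally_finite_singleton: "locally_finite {x} sz"
  by (simp add: locally_finite_def)

lemma locally_finite_Un:
  assumes "locally_finite X sz" "locally_finite Y sz"
  shows "locally_finite (X \<union> Y) sz"
  unfolding locally_finite_def
proof
  fix N
  have "{s \<in> X \<union> Y. sz s \<le> N} = {s \<in> X. sz s \<le> N} \<union> {s \<in> Y. sz s \<le> N}" by auto
  thus "finite {s \<in> X \<union> Y. sz s \<le> N}"
    using locally_finiteD[OF assms(1), of N] locally_finiteD[OF assms(2), of N] by simp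
qed

lemma locally_finite_image:
  assumes "locally_finite X sz" "\<And>s. s \<in> X \<Longrightarrow> sz s \<le> sz' (f s)"
  shows "locally_finite (f ` X) sz'"
  unfolding locally_finite_def
proof
  fix N
  have "{t \<in> f ` X. sz' t \<le> N} \<subseteq> f ` {s \<in> X. sz s \<le> N}"
    using assms(2) order_trans by fast
  thus "finite {t \<in> f ` X. sz' t \<le> N}"
    using locally_finiteD[OF assms(1)] finite_surj by blast
qed

lemma locally_finite_Times:
  assumes "locally_finite X f" "locally_finite Y g"
  shows "locally_finite (X \<times> Y) (\<lambda>(x, y). f x + g y)"
  unfolding locally_finite_def
proof
  fix N
  have "{s \<in> X \<times> Y. (case s of (x, y) \<Rightarrow> f x + g y) \<le> N} \<subseteq> {x \<in> X. f x \<le> N} \<times> {y \<in> Y. g y \<le> N}"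
    by auto
  thus "finite {s \<in> X \<times> Y. (case s of (x, y) \<Rightarrow> f x + g y) \<le> N}"
    using assms by (rule finite_subset[OF _ finite_cartesian_product[OF locally_finiteD locally_finiteD]])
qed

lemma locally_finite_Sigma:
  assumes "locally_finite X f" "\<And>x. x \<in> X \<Longrightarrow> finite (I x)"
  shows "locally_finite (Sigma X I) (\<lambda>(x, i). f x)"
  unfolding locally_finite_def
proof
  fix N
  have "{s \<in> Sigma X I. (case s of (x, y) \<Rightarrow> f x) \<le> N} = Sigma {x \<in> X. f x \<le> N} I"
    by auto
  thus "finite {s \<in> Sigma X I. (case s of (x, y) \<Rightarrow> f x) \<le> N}"
    using assms locally_finiteD[OF assms(1), of N] by (auto intro!: finite_SigmaI)
qed

text \<open>Objects of size above \<open>N\<close> contribute only multiples of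
  \<open>fps_X ^ Suc N\<close>, so any later cutoff gives the same coefficient. One finite sum thus
  represents all coefficients up to \<open>M\<close>, as products require.\<close>

lemma gf_nth:
  assumes "locally_finite X sz" "N \<le> M"
  shows "gf X sz wt $ N = (\<Sum>s | s \<in> X \<and> sz s \<le> M. fps_X ^ sz s * wt s) $ N"
  unfolding gf_def fps_nth_Abs_fps fps_sum_nth
  using assms(2) locally_finiteD[OF assms(1), of M]
  by (intro sum.mono_neutral_left) (auto simp: fps_X_power_mult_nth)

section \<open>Unions, bijections, products and finite choices\<close>

lemma gf_cong:
  assumes "X = Y" "\<And>s. s \<in> Y \<Longrightarrow> sz s = sz' s" "\<And>s. s \<in> Y \<Longrightarrow> wt s = wt' s"
  shows "gf X sz wt = gf Y sz' wt'"
proof -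
  have "{s \<in> X. sz s \<le> N} = {s \<in> Y. sz' s \<le> N}" for N using assms by auto
  thus ?thesis unfolding gf_def using assms by (auto intro!: fps_ext sum.cong simp: fps_sum_nth)
qed

lemma gf_Un:
  assumes "locally_finite X sz" "locally_finite Y sz" "X \<inter> Y = {}"
  shows "gf (X \<union> Y) sz wt = gf X sz wt + gf Y sz wt"
proof (rule fps_ext)
  fix N
  have "{s. s \<in> X \<union> Y \<and> sz s \<le> N} = {s. s \<in> X \<and> sz s \<le> N} \<union> {s. s \<in> Y \<and> sz s \<le> N}" by auto
  moreover have "{s. s \<in> X \<and> sz s \<le> N} \<inter> {s. s \<in> Y \<and> sz s \<le> N} = {}" using assms(3) by auto
  ultimately show "gf (X \<union> Y) sz wt $ N = (gf X sz wt + gf Y sz wt) $ N"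
    using locally_finiteD[OF assms(1), of N] locally_finiteD[OF assms(2), of N]
    by (simp add: gf_def sum.union_disjoint)
qed

lemma gf_singleton: "gf {s} sz wt = fps_X ^ sz s * wt s"
proof (rule fps_ext)
  fix N
  show "gf {s} sz wt $ N = (fps_X ^ sz s * wt s) $ N"
  proof (cases "sz s \<le> N")
    case True
    hence "{t. t \<in> {s} \<and> sz t \<le> N} = {s}" by auto
    thus ?thesis by (simp only: gf_def fps_nth_Abs_fps) simp
  next
    case False
    hence "{t. t \<in> {s} \<and> sz t \<le> N} = {}" by auto
    thus ?thesis
      unfolding gf_def fps_nth_Abs_fps using False by (simp only:) (simp add: fps_X_power_mult_nth)
  qed
qed

lemma fps_mult_nth_cong:
  assumes "\<And>N. N \<le> M \<Longrightarrow> f $ N = f' $ N" "\<And>N. N \<le> M \<Longrightarrow> g $ N = g' $ N"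
  shows "(f * g :: 'b::comm_ring_1 fps) $ M = (f' * g') $ M"
  unfolding fps_mult_nth using assms by (intro sum.cong) auto

text \<open>The transfer rule for a combinatorial bijection that adds \<open>k\<close> to every size
  and a factor \<open>c\<close> to every weight; every recursion for a generating function below
  passes through it.\<close>

lemma gf_image:
  assumes "locally_finite X sz" "inj_on f X"
    and "\<And>s. s \<in> X \<Longrightarrow> sz' (f s) = sz s + k" "\<And>s. s \<in> X \<Longrightarrow> wt' (f s) = c * wt s"
  shows "gf (f ` X) sz' wt' = fps_X ^ k * c * gf X sz wt"
proof (rule fps_ext)
  fix N
  let ?A = "{s. s \<in> X \<and> sz s + k \<le> N}" and ?B = "{s. s \<in> X \<and> sz s \<le> N}"
  have "{t. t \<in> f ` X \<and> sz' t \<le> N} = f ` ?A" using assms(3) by auto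
  hence "gf (f ` X) sz' wt' $ N = (\<Sum>s\<in>f ` ?A. fps_X ^ sz' s * wt' s) $ N"
    by (simp add: gf_def)
  also have "\<dots> = (\<Sum>s\<in>?A. fps_X ^ (sz s + k) * (c * wt s)) $ N"
    using assms(3,4) inj_on_subset[OF assms(2), of ?A]
    by (subst sum.reindex) (auto intro!: arg_cong[of _ _ "\<lambda>f. f $ N"] sum.cong)
  also have "\<dots> = (\<Sum>s\<in>?B. fps_X ^ (sz s + k) * (c * wt s)) $ N"
    unfolding fps_sum_nth using locally_finiteD[OF assms(1), of N]
    by (intro sum.mono_neutral_left) (auto simp: fps_X_power_mult_nth)
  also have "(\<Sum>s\<in>?B. fps_X ^ (sz s + k) * (c * wt s)) =
      fps_X ^ k * c * (\<Sum>s\<in>?B. fps_X ^ sz s * wt s)"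
    by (simp add: sum_distrib_left power_add mult_ac)
  also have "\<dots> $ N = (fps_X ^ k * c * gf X sz wt) $ N"
    by (intro fps_mult_nth_cong) (simp_all add: gf_nth[OF assms(1)])
  finally show "gf (f ` X) sz' wt' $ N = \<dots>" .
qed

lemma gf_Times:
  assumes X: "locally_finite X f" and Y: "locally_finite Y g"
  shows "gf (X \<times> Y) (\<lambda>(x, y). f x + g y) (\<lambda>(x, y). u x * v y) = gf X f u * gf Y g v"
proof (rule fps_ext)
  fix N
  let ?XY = "{x. x \<in> X \<and> f x \<le> N} \<times> {y. y \<in> Y \<and> g y \<le> N}"
  have "(gf X f u * gf Y g v) $ N =
      ((\<Sum>x | x \<in> X \<and> f x \<le> N. fps_X ^ f x * u x) * (\<Sum>y | y \<in> Y \<and> g y \<le> N. fps_X ^ g y * v y)) $ N"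
    by (intro fps_mult_nth_cong) (simp_all add: gf_nth[OF X] gf_nth[OF Y])
  also have "\<dots> = (\<Sum>(x, y)\<in>?XY. fps_X ^ (f x + g y) * (u x * v y)) $ N"
    by (simp add: sum_product sum.cartesian_product power_add mult_ac)
  \<comment> \<open>The pairs in the rectangle \<open>?XY\<close> whose total size exceeds
    \<open>N\<close> do not reach coefficient \<open>N\<close>.\<close>
  also have "\<dots> = (\<Sum>s | s \<in> X \<times> Y \<and> (case s of (x, y) \<Rightarrow> f x + g y) \<le> N.
      fps_X ^ (case s of (x, y) \<Rightarrow> f x + g y) * (case s of (x, y) \<Rightarrow> u x * v y)) $ N"
    unfolding fps_sum_nth case_prod_unfold
    using finite_cartesian_product[OF locally_finiteD[OF X, of N] locally_finiteD[OF Y, of N]]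
    by (intro sum.mono_neutral_right) (auto simp: fps_X_power_mult_nth)
  also have "\<dots> = gf (X \<times> Y) (\<lambda>(x, y). f x + g y) (\<lambda>(x, y). u x * v y) $ N"
    by (simp only: gf_def fps_nth_Abs_fps)
  finally show "gf (X \<times> Y) (\<lambda>(x, y). f x + g y) (\<lambda>(x, y). u x * v y) $ N = (gf X f u * gf Y g v) $ N"
    by (rule sym)
qed

text \<open>For an additional choice \<open>i\<close> that affects the weight but not the size, such
  as the length of a marked suffix: it can be summed out object by object.\<close>

lemma gf_Sigma:
  assumes "locally_finite X f" "\<And>x. x \<in> X \<Longrightarrow> finite (I x)"
  shows "gf (Sigma X I) (\<lambda>(x, i). f x) (\<lambda>(x, i). w x i) = gf X f (\<lambda>x. \<Sum>i\<in>I x. w x i)"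
proof (rule fps_ext)
  fix N
  have "{s. s \<in> Sigma X I \<and> (case s of (x, i) \<Rightarrow> f x) \<le> N} = Sigma {x. x \<in> X \<and> f x \<le> N} I"
    by auto
  thus "gf (Sigma X I) (\<lambda>(x, i). f x) (\<lambda>(x, i). w x i) $ N = gf X f (\<lambda>x. \<Sum>i\<in>I x. w x i) $ N"
    using assms locally_finiteD[OF assms(1), of N]
    by (auto simp: gf_def sum.Sigma case_prod_unfold sum_distrib_left intro!: arg_cong[of _ _ "\<lambda>f. f $ N"])
qed

lemma gf_mult_left:
  assumes "locally_finite X sz"
  shows "gf X sz (\<lambda>s. c * wt s) = c * gf X sz wt"
  using gf_image[OF assms, of "\<lambda>s. s" sz 0 "\<lambda>s. c * wt s" c wt] by simp

lemma gf_diff: "gf X sz (\<lambda>s. u s - v s) = gf X sz u - gf X sz v"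
  by (rule fps_ext) (simp add: gf_def fps_sum_nth right_diff_distrib sum_subtractf)

text \<open>Linearity makes the series nonexpansive in the weight; this becomes continuity in the
  marking variable.\<close>

lemma gf_dvd_diff:
  fixes u v :: "'a \<Rightarrow> 'b::comm_ring_1 fps"
  assumes "\<And>s. s \<in> X \<Longrightarrow> fps_X ^ n dvd u s - v s"
  shows "fps_X ^ n dvd gf X sz u - gf X sz v"
  unfolding fps_X_power_dvd_iff gf_diff[symmetric]
proof (intro allI impI)
  fix i assume "i < n"
  have "fps_X ^ n dvd (\<Sum>s | s \<in> X \<and> sz s \<le> i. fps_X ^ sz s * (u s - v s))"
    using assms by (intro dvd_sum dvd_mult) auto
  thus "gf X sz (\<lambda>s. u s - v s) $ i = 0"
    using \<open>i < n\<close> unfolding fps_X_power_dvd_iff by (simp add: gf_def)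
qed

section \<open>Avoidance of 2413 and 3412\<close>

text \<open>The order of \<open>a\<close> and \<open>d\<close> is left open, which merges both
  patterns into one condition. It is stated for arbitrary lists, so that it passes to subsequences
  and shifted blocks without relabelling.\<close>

definition good :: "nat list \<Rightarrow> bool" where
  "good p \<longleftrightarrow> (\<forall>a b c d. subseq [a, b, c, d] p \<longrightarrow> c < a \<longrightarrow> c < d \<longrightarrow> a < b \<longrightarrow> d < b \<longrightarrow> False)"

lemma goodD: "good p \<Longrightarrow> subseq [a, b, c, d] p \<Longrightarrow> c < a \<Longrightarrow> c < d \<Longrightarrow> a < b \<Longrightarrow> d < b \<Longrightarrow> False"
  unfolding good_def by blast

lemma good_subseq: "good p \<Longrightarrow> subseq q p \<Longrightarrow> good q"
  unfolding good_def by (meson subseq_order.order_trans)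

section \<open>Pattern containment in terms of subsequences\<close>

lemma subseq_map_nth:
  assumes "strict_mono_on {..<k} i" "i ` {..<k} \<subseteq> {..<length p}"
  shows "subseq (map (\<lambda>a. p ! i a) [0..<k]) p"
proof -
  \<comment> \<open>An increasing index map lists its image in sorted order, and sorted positions
    form a subsequence of all positions; applying \<open>(!) p\<close> to both carries this over to
    the entries.\<close>
  have "map i [0..<k] = sorted_list_of_set (i ` {..<k})"
  proof (rule sorted_distinct_set_unique)
    show "sorted (map i [0..<k])"
      by (auto simp: sorted_iff_nth_mono intro!: strict_mono_on_leD[OF assms(1)])
    show "distinct (map i [0..<k])"
      using strict_mono_on_imp_inj_on[OF assms(1)] by (simp add: distinct_map atLeast0LessThan)
  qed (auto simp: atLeast0LessThan)
  moreover have "subseq (sorted_list_of_set (i ` {..<k})) [0..<length p]"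
    using assms(2) by (intro sorted_subset_imp_subseq) (auto simp: sorted_wrt_upt)
  ultimately have "subseq (map ((!) p) (map i [0..<k])) (map ((!) p) [0..<length p])"
    by (metis subseq_map)
  thus ?thesis
    by (simp add: map_nth comp_def)
qed

lemma subseq_imp_indices:
  assumes "subseq xs p"
  shows "\<exists>i. strict_mono_on {..<length xs} i \<and> i ` {..<length xs} \<subseteq> {..<length p} \<and>
             (\<forall>a<length xs. xs ! a = p ! i a)"
  using assms
proof (induction rule: list_emb.induct)
  case (list_emb_Nil ys)
  show ?case by (auto simp: strict_mono_on_def)
next
  case (list_emb_Cons xs ys y)
  then obtain i where "strict_mono_on {..<length xs} i" "i ` {..<length xs} \<subseteq> {..<length ys}"
     "\<forall>a<length xs. xs ! a = ys ! i a" by blast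
  thus ?case
    by (intro exI[of _ "\<lambda>a. Suc (i a)"]) (auto simp: strict_mono_on_def)
next
  case (list_emb_Cons2 x y xs ys)
  then obtain i where "strict_mono_on {..<length xs} i" "i ` {..<length xs} \<subseteq> {..<length ys}"
     "\<forall>a<length xs. xs ! a = ys ! i a" by blast
  thus ?case using \<open>x = y\<close>
    by (intro exI[of _ "\<lambda>a. case a of 0 \<Rightarrow> 0 | Suc b \<Rightarrow> Suc (i b)"])
       (auto simp: strict_mono_on_def nth_Cons image_subset_iff split: nat.splits)
qed

text \<open>Trades index functions for \<open>subseq\<close>, so that filtering and concatenation
  can act on occurrences of a pattern directly.\<close>

lemma contains_iff_subseq:
  "contains p s \<longleftrightarrow> (\<exists>xs. subseq xs p \<and> length xs = length s \<and>
     (\<forall>a<length s. \<forall>b<length s. xs ! a < xs ! b \<longleftrightarrow> s ! a < s ! b))"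
proof
  assume "contains p s"
  then obtain i where i: "strict_mono_on {..<length s} i" "i ` {..<length s} \<subseteq> {..<length p}"
    "\<forall>a<length s. \<forall>b<length s. p ! i a < p ! i b \<longleftrightarrow> s ! a < s ! b"
    unfolding contains_def by blast
  show "\<exists>xs. subseq xs p \<and> length xs = length s \<and>
     (\<forall>a<length s. \<forall>b<length s. xs ! a < xs ! b \<longleftrightarrow> s ! a < s ! b)"
    using i(3) by (intro exI[of _ "map (\<lambda>a. p ! i a) [0..<length s]"])
      (auto intro!: subseq_map_nth i)
next
  assume "\<exists>xs. subseq xs p \<and> length xs = length s \<and>
     (\<forall>a<length s. \<forall>b<length s. xs ! a < xs ! b \<longleftrightarrow> s ! a < s ! b)"
  then obtain xs where xs: "subseq xs p" "length xs = length s"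
     "\<forall>a<length s. \<forall>b<length s. xs ! a < xs ! b \<longleftrightarrow> s ! a < s ! b" by blast
  from subseq_imp_indices[OF xs(1)] obtain i where
    "strict_mono_on {..<length xs} i" "i ` {..<length xs} \<subseteq> {..<length p}"
    "\<forall>a<length xs. xs ! a = p ! i a" by blast
  thus "contains p s"
    unfolding contains_def using xs by (intro exI[of _ i]) auto
qed

lemma length_4E:
  assumes "length xs = 4"
  obtains a b c d where "xs = [a, b, c, d]"
  using assms by (auto simp: eval_nat_numeral length_Suc_conv)

lemma all_less_4: "(\<forall>a<4. Q a) \<longleftrightarrow> Q 0 \<and> Q (Suc 0) \<and> Q 2 \<and> Q (3::nat)"
  by (auto simp: eval_nat_numeral less_Suc_eq)

lemma contains_iff_subseq_4:
  assumes "length s = 4"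
  shows "contains p s \<longleftrightarrow> (\<exists>a b c d. subseq [a, b, c, d] p \<and>
     (\<forall>i<4. \<forall>j<4. [a, b, c, d] ! i < [a, b, c, d] ! j \<longleftrightarrow> s ! i < s ! j))"
  unfolding contains_iff_subseq assms
proof safe
  fix xs assume "subseq xs p" "length xs = 4" "\<forall>i<4. \<forall>j<4. xs ! i < xs ! j \<longleftrightarrow> s ! i < s ! j"
  moreover obtain a b c d where "xs = [a, b, c, d]"
    using length_4E[OF \<open>length xs = 4\<close>] .
  ultimately show "\<exists>a b c d. subseq [a, b, c, d] p \<and>
     (\<forall>i<4. \<forall>j<4. [a, b, c, d] ! i < [a, b, c, d] ! j \<longleftrightarrow> s ! i < s ! j)"
    by blast
next
  fix a b c d
  assume "subseq [a, b, c, d] p"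
    "\<forall>i<4. \<forall>j<4. [a, b, c, d] ! i < [a, b, c, d] ! j \<longleftrightarrow> s ! i < s ! j"
  thus "\<exists>xs. subseq xs p \<and> length xs = 4 \<and>
     (\<forall>i<4. \<forall>j<4. xs ! i < xs ! j \<longleftrightarrow> s ! i < s ! j)"
    by (intro exI[of _ "[a, b, c, d]"]) auto
qed

lemma contains_2413:
  "contains p [2,4,1,3] \<longleftrightarrow> (\<exists>a b c d. subseq [a, b, c, d] p \<and> c < a \<and> a < d \<and> d < b)"
proof -
  have "(\<forall>i<4. \<forall>j<4. [a, b, c, d] ! i < [a, b, c, d] ! j \<longleftrightarrow> [2,4,1,3::nat] ! i < [2,4,1,3] ! j)
     \<longleftrightarrow> c < a \<and> a < d \<and> d < b" for a b c d :: nat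
    unfolding all_less_4 by (simp add: nth_Cons') linarith
  thus ?thesis by (subst contains_iff_subseq_4) simp_all
qed

lemma contains_3412:
  "contains p [3,4,1,2] \<longleftrightarrow> (\<exists>a b c d. subseq [a, b, c, d] p \<and> c < d \<and> d < a \<and> a < b)"
proof -
  have "(\<forall>i<4. \<forall>j<4. [a, b, c, d] ! i < [a, b, c, d] ! j \<longleftrightarrow> [3,4,1,2::nat] ! i < [3,4,1,2] ! j)
     \<longleftrightarrow> c < d \<and> d < a \<and> a < b" for a b c d :: nat
    unfolding all_less_4 by (simp add: nth_Cons') linarith
  thus ?thesis by (subst contains_iff_subseq_4) simp_all
qed

definition avoiders :: "nat list set" where
  "avoiders = Av {[2,4,1,3], [3,4,1,2]}"

lemma avoiders_iff: "p \<in> avoiders \<longleftrightarrow> set p = {1..length p} \<and> distinct p \<and> good p"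
proof -
  have "is_perm p \<longleftrightarrow> set p = {1..length p} \<and> distinct p"
    by (auto simp: is_perm_def permutations_of_set_def)
  moreover have "good p \<longleftrightarrow> avoids p [2,4,1,3] \<and> avoids p [3,4,1,2]" if "distinct p"
  proof
    assume "good p"
    thus "avoids p [2,4,1,3] \<and> avoids p [3,4,1,2]"
      unfolding contains_2413 contains_3412
      by (meson goodD less_trans)
  next
    assume *: "avoids p [2,4,1,3] \<and> avoids p [3,4,1,2]"
    show "good p" unfolding good_def
    proof (intro allI impI)
      fix a b c d assume **: "subseq [a, b, c, d] p" "c < a" "c < d" "a < b" "d < b"
      \<comment> \<open>Distinctness separates \<open>a\<close> from \<open>d\<close>, and their
        order decides between 2413 and 3412.\<close>
      have "distinct [a, b, c, d]"
        using **(1) that by (metis subseq_conv_nths distinct_nthsI)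
      hence "a < d \<or> d < a" by auto
      thus False
        using * ** unfolding contains_2413 contains_3412 by blast
    qed
  qed
  ultimately show ?thesis
    by (auto simp: avoiders_def Av_def)
qed

section \<open>Splitting an avoider at its maximum\<close>

abbreviation decr :: "nat list \<Rightarrow> bool" where
  "decr \<equiv> sorted_wrt (>)"

lemma subseq_imp_set_subset: "subseq xs ys \<Longrightarrow> set xs \<subseteq> set ys"
  by (induction rule: list_emb.induct) auto

lemma decr_subseq:
  assumes "decr xs" "subseq ys xs"
  shows "decr ys"
  using assms(2,1) by (induction rule: list_emb.induct) (auto dest: subseq_imp_set_subset)

text \<open>The head must be matched inside \<open>zs\<close>, and the remaining entries come after
  it.\<close>

lemma subseq_append_notin:
  assumes "subseq (x # xs) (ys @ zs)" "x \<notin> set ys"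
  shows "subseq (x # xs) zs"
  using assms by (induction ys) (auto split: if_splits dest: subseq_Cons2_neq)

text \<open>Compare \<open>m\<close> with the largest entry \<open>b\<close> and the smallest entry
  \<open>c\<close> of a forbidden occurrence. If \<open>b \<le> m\<close>, it lies in
  \<open>A @ D\<close>; if \<open>c > m\<close>, it lies in \<open>N # B\<close>. Otherwise
  \<open>b\<close> is not in \<open>A\<close>, so the smaller \<open>c\<close> and the
  \<open>d\<close> after it both lie in \<open>D\<close>, which decreases although
  \<open>c < d\<close>.\<close>

lemma good_insert:
  assumes "good (A @ D)" "good B" "decr D"
    and "\<forall>x\<in>set A \<union> set D. x \<le> m" "\<forall>x\<in>set B. m < x \<and> x < N" "m < N"
  shows "good (A @ N # B @ D)"
  unfolding good_def
proof (intro allI impI)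
  fix a b c d
  assume sub: "subseq [a, b, c, d] (A @ N # B @ D)" and lt: "c < a" "c < d" "a < b" "d < b"
  show False
  proof (cases "b \<le> m")
    case True
    have "subseq (filter (\<lambda>x. x \<le> m) [a, b, c, d]) (filter (\<lambda>x. x \<le> m) (A @ N # B @ D))"
      using sub by (rule subseq_filter)
    also have "filter (\<lambda>x. x \<le> m) [a, b, c, d] = [a, b, c, d]"
      using True lt by auto
    also have "filter (\<lambda>x. x \<le> m) (A @ N # B @ D) = A @ D"
    proof -
      have "filter (\<lambda>x. x \<le> m) A = A" "filter (\<lambda>x. x \<le> m) D = D" "filter (\<lambda>x. x \<le> m) B = []"
        unfolding filter_id_conv filter_empty_conv using assms(4,5) by auto
      thus ?thesis using assms(6) by simp
    qed
    finally show False using goodD[OF assms(1)] lt by blast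
  next
    case False
    show False
    proof (cases "c \<le> m")
      case True
      have "b \<notin> set A" using False assms(4) by blast
      from subseq_append_notin[OF subseq_Cons'[OF sub] this]
      have "subseq [b, c, d] ((N # B) @ D)" by (simp only: append_Cons)
      moreover have "c \<notin> set (N # B)"
        using True assms(5,6) by auto
      ultimately have "subseq [c, d] D"
        using subseq_append_notin subseq_Cons' by metis
      hence "decr [c, d]"
        by (rule decr_subseq[OF assms(3)])
      thus False using lt by simp
    next
      case c: False
      have "subseq (filter (\<lambda>x. x > m) [a, b, c, d]) (filter (\<lambda>x. x > m) (A @ N # B @ D))"
        using sub by (rule subseq_filter)
      also have "filter (\<lambda>x. x > m) [a, b, c, d] = [a, b, c, d]"
        using c lt by auto
      also have "filter (\<lambda>x. x > m) (A @ N # B @ D) = N # B"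
      proof -
        have "filter (\<lambda>x. m < x) A = []" "filter (\<lambda>x. m < x) D = []" "filter (\<lambda>x. m < x) B = B"
          unfolding filter_id_conv filter_empty_conv using assms(4,5) by (auto simp: not_less)
        thus ?thesis using assms(6) by simp
      qed
      finally have *: "subseq [a, b, c, d] (N # B)" .
      have "subseq [b, c, d] (N # B)"
        using subseq_Cons'[OF *] .
      hence "b \<in> set (N # B)"
        using subseq_imp_set_subset by fastforce
      \<comment> \<open>Nothing in \<open>N # B\<close> exceeds \<open>N\<close>, whereas
        \<open>a < b\<close>; so the occurrence lies in \<open>B\<close>.\<close>
      hence "a \<noteq> N" using lt assms(5) by auto
      hence "subseq [a, b, c, d] B" using * subseq_Cons2_neq by metis
      thus False using goodD[OF assms(2)] lt by blast
    qed
  qed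
qed

text \<open>
  Inserts a new maximum followed by a copy of \<open>B\<close>, shifted above all other entries, between
  \<open>A\<close> and \<open>D\<close>.
\<close>

definition ins :: "nat list \<times> nat list \<Rightarrow> nat list \<Rightarrow> nat list" where
  "ins = (\<lambda>(A, D) B. A @ (length A + length D + length B + 1) # map ((+) (length A + length D)) B @ D)"

text \<open>
  A pair \<open>(A, D)\<close> stands for the avoider \<open>A @ D\<close> with the decreasing suffix \<open>D\<close> marked.
  In \<open>marked_low\<close> the maximum, which equals the length, must lie outside of the marked suffix.
\<close>

definition marked :: "(nat list \<times> nat list) set" where
  "marked = {(A, D). A @ D \<in> avoiders \<and> decr D}"

definition marked_low :: "(nat list \<times> nat list) set" where
  "marked_low = {(A, D). A @ D \<in> avoiders \<and> decr D \<and> length A + length D \<notin> set D}"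

lemma good_map_plus [simp]: "good (map ((+) m) B) \<longleftrightarrow> good B"
proof
  assume g: "good (map ((+) m) B)"
  show "good B" unfolding good_def
  proof (intro allI impI)
    fix a b c d assume "subseq [a, b, c, d] B" and lt: "c < a" "c < d" "a < b" "d < b"
    from subseq_map[OF this(1), of "(+) m"] show False
      using goodD[OF g, of "m + a" "m + b" "m + c" "m + d"] lt by simp
  qed
next
  assume g: "good B"
  show "good (map ((+) m) B)" unfolding good_def
  proof (intro allI impI)
    fix a b c d assume *: "subseq [a, b, c, d] (map ((+) m) B)" and lt: "c < a" "c < d" "a < b" "d < b"
    have "subseq (map (\<lambda>x. x - m) [a, b, c, d]) (map (\<lambda>x. x - m) (map ((+) m) B))"
      using * by (rule subseq_map)
    hence "subseq [a - m, b - m, c - m, d - m] B" by (simp add: comp_def)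
    \<comment> \<open>The bounds obtained from this make the truncated subtraction of
      \<open>m\<close> reversible, so it preserves strict comparisons.\<close>
    moreover have "set [a, b, c, d] \<subseteq> set (map ((+) m) B)"
      using * by (metis subseq_conv_nths set_nths_subset)
    hence "a \<ge> m" "b \<ge> m" "c \<ge> m" "d \<ge> m" by auto
    ultimately show False
      using goodD[OF g, of "a - m" "b - m" "c - m" "d - m"] lt by linarith
  qed
qed

lemma set_map_plus: "set B = {1..j} \<Longrightarrow> set (map ((+) m) B) = {m+1..m+j}" for m j :: nat
  using image_add_atLeastAtMost[of m 1 j] by (simp add: add.commute)

lemma ins_in_avoiders:
  assumes "(A, D) \<in> marked" "B \<in> avoiders"
  shows "ins (A, D) B \<in> avoiders"
proof -
  define m where "m = length A + length D"
  have AD: "set A \<union> set D = {1..m}" "distinct (A @ D)" "good (A @ D)" "decr D"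
    using assms(1) by (auto simp: marked_def avoiders_iff m_def)
  have B: "set B = {1..length B}" "distinct B" "good B"
    using assms(2) by (auto simp: avoiders_iff)
  note B' = set_map_plus[OF B(1), of m]
  have mem: "x \<in> set A \<Longrightarrow> x \<le> m" "x \<in> set D \<Longrightarrow> x \<le> m" for x
    using AD(1) by auto
  have "good (A @ (m + length B + 1) # map ((+) m) B @ D)"
    using AD B B' by (intro good_insert[of _ _ _ m]) auto
  moreover have "distinct (A @ (m + length B + 1) # map ((+) m) B @ D)"
  proof -
    have "set A \<inter> {m+1..m+length B} = {}" "set D \<inter> {m+1..m+length B} = {}"
      "m + length B + 1 \<notin> set A" "m + length B + 1 \<notin> set D"
      using mem by fastforce+
    moreover have "distinct (map ((+) m) B)" using B(2) by (simp add: distinct_map)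
    ultimately show ?thesis
      using AD(2) unfolding distinct_append distinct.simps set_append list.set B' by auto
  qed
  moreover have "set (A @ (m + length B + 1) # map ((+) m) B @ D) =
      {1..length (A @ (m + length B + 1) # map ((+) m) B @ D)}"
  proof -
    have "set (A @ (m + length B + 1) # map ((+) m) B @ D) =
       {1..m} \<union> set (map ((+) m) B) \<union> {m + length B + 1}"
      using AD(1) by auto
    also have "\<dots> = {1..m + length B + 1}"
      unfolding B' by auto
    finally show ?thesis by (simp add: m_def)
  qed
  ultimately show ?thesis
    unfolding ins_def prod.case m_def[symmetric] avoiders_iff by blast
qed

text \<open>Let \<open>N\<close> be the maximum and \<open>m\<close> the largest entry before it. If
  \<open>x < y\<close> appear after \<open>N\<close> in this order with \<open>x < m\<close>, then
  \<open>m N x y\<close> is forbidden. Hence once an entry after \<open>N\<close> falls below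
  \<open>m\<close>, the rest decreases; this cuts the part after \<open>N\<close> into
  \<open>B\<close> above \<open>m\<close> and the decreasing \<open>D\<close> below
  \<open>m\<close>.\<close>

lemma avoiders_decompose:
  assumes "p \<in> avoiders" "p \<noteq> []"
  obtains A D B where "(A, D) \<in> marked_low" "B \<in> avoiders"
    "p = ins (A, D) B"
proof -
  define N where "N = length p"
  have p: "set p = {1..N}" "distinct p" "good p"
    using assms by (auto simp: avoiders_iff N_def)
  have "N \<in> set p" using p(1) assms(2) by (simp add: N_def Suc_leI)
  then obtain A R where AR: "p = A @ N # R" by (auto dest: split_list)
  \<comment> \<open>The inserted 0 covers an empty \<open>A\<close>; then \<open>B\<close> takes
    everything after \<open>N\<close> and \<open>D\<close> is empty.\<close>
  define m where "m = Max (insert 0 (set A))"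
  have le_m: "x \<le> m" if "x \<in> set A" for x
    using that by (simp add: m_def)
  have m_in: "m \<in> insert 0 (set A)"
    unfolding m_def by (intro Max_in) auto
  have less_N: "x < N" if "x \<in> set A \<union> set R" for x
  proof -
    have "x \<in> {1..N}" using that unfolding p(1)[symmetric] AR by auto
    moreover have "x \<noteq> N" using that p(2) unfolding AR by auto
    ultimately show ?thesis by simp
  qed
  have "m < N" using m_in less_N[of m] assms(2) by (auto simp: N_def)
  define B where "B = takeWhile (\<lambda>x. m < x) R"
  define D where "D = dropWhile (\<lambda>x. m < x) R"
  have R: "R = B @ D" by (simp add: B_def D_def)
  have m_notin: "m \<notin> set D"
    using m_in p(1,2) by (auto simp: AR R)
  have desc: "y < x" if "subseq [x, y] D" "x < m" for x y
  proof (rule ccontr)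
    assume "\<not> y < x"
    moreover have "distinct [x, y]"
    proof -
      have "distinct D" using p(2) by (simp add: AR R)
      thus ?thesis using that(1) unfolding subseq_conv_nths by (metis distinct_nthsI)
    qed
    ultimately have "x < y" by auto
    have "m \<in> set A" using m_in that(2) by auto
    hence "subseq ([m] @ [N] @ [x, y]) (A @ [N] @ R)"
      using that(1) by (intro list_emb_append_mono) (auto simp: subseq_singleton_left R)
    moreover have "y \<in> set R"
      using subseq_imp_set_subset[OF that(1)] by (simp add: R)
    ultimately have "subseq [m, N, x, y] p" "y < N"
      using less_N[of y] by (auto simp: AR)
    thus False
      using goodD[OF p(3)] \<open>x < y\<close> that(2) \<open>m < N\<close> by blast
  qed
  \<comment> \<open>The first entry of \<open>D\<close> ended \<open>takeWhile\<close> and differs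
    from \<open>m\<close>, so it is below \<open>m\<close>; by \<open>desc\<close> every later entry
    is smaller still.\<close>
  have small: "x < m" if "x \<in> set D" for x
  proof (cases D)
    case (Cons d D')
    have "\<not> m < d" using Cons unfolding D_def by (metis dropWhile_eq_Cons_conv)
    moreover have "d \<noteq> m" using m_notin Cons by auto
    ultimately have "d < m" by simp
    have "x = d \<or> x \<in> set D'" using that Cons by simp
    thus ?thesis
    proof
      assume "x \<in> set D'"
      hence "subseq [d, x] D" by (simp add: Cons subseq_singleton_left)
      hence "x < d" using \<open>d < m\<close> by (rule desc)
      thus ?thesis using \<open>d < m\<close> by simp
    qed (simp add: \<open>d < m\<close>)
  qed (use that in auto)
  have "decr D"
    unfolding sorted_wrt_iff_nth_less
  proof (intro allI impI)
    fix i j assume ij: "i < j" "j < length D"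
    have "subseq [D ! i, D ! j] D"
    proof -
      have "D = take i D @ D ! i # drop (Suc i) D"
        using ij by (simp add: id_take_nth_drop)
      moreover have "D ! j \<in> set (drop (Suc i) D)"
        using ij by (auto simp: in_set_conv_nth intro!: exI[of _ "j - Suc i"])
      ultimately show ?thesis
        by (metis subseq_Cons2 subseq_drop_many subseq_singleton_left)
    qed
    moreover have "D ! i < m" using ij by (intro small) auto
    ultimately show "D ! i > D ! j" by (rule desc)
  qed
  have B_gt: "m < x" if "x \<in> set B" for x
    using that unfolding B_def by (auto dest: set_takeWhileD)
  have sets: "set A \<union> set D = {1..m}" "set B = {m+1..N-1}"
  proof -
    have *: "{1..N} = set A \<union> set D \<union> set B \<union> {N}"
      using p(1) by (auto simp: AR R)
    show "set A \<union> set D = {1..m}"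
    proof (intro equalityI subsetI)
      fix x assume "x \<in> set A \<union> set D"
      moreover from this have "x \<in> {1..N}" unfolding * by blast
      ultimately show "x \<in> {1..m}" using le_m[of x] small[of x] by auto
    next
      fix x assume "x \<in> {1..m}"
      hence "x \<in> {1..N}" using \<open>m < N\<close> by auto
      hence "x \<in> set A \<union> set D \<union> set B \<union> {N}" by (simp only: *)
      moreover have "x \<notin> set B" "x \<noteq> N"
        using \<open>x \<in> {1..m}\<close> B_gt[of x] \<open>m < N\<close> by auto
      ultimately show "x \<in> set A \<union> set D" by blast
    qed
    show "set B = {m+1..N-1}"
    proof (intro equalityI subsetI)
      fix x assume "x \<in> set B"
      moreover from this have "x \<noteq> N" using p(2) by (auto simp: AR R)
      moreover have "x \<in> {1..N}" using \<open>x \<in> set B\<close> unfolding * by blast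
      ultimately show "x \<in> {m+1..N-1}" using B_gt[of x] by auto
    next
      fix x assume x: "x \<in> {m+1..N-1}"
      hence "x \<in> {1..N}" by auto
      hence "x \<in> set A \<union> set D \<union> set B \<union> {N}" by (simp only: *)
      moreover have "x \<noteq> N" "x \<notin> set A" "x \<notin> set D"
        using x le_m[of x] small[of x] by auto
      ultimately show "x \<in> set B" by blast
    qed
  qed
  have dist: "distinct (A @ D)" "distinct B" using p(2) by (auto simp: AR R)
  have m: "length A + length D = m"
    using distinct_card[OF dist(1)] sets(1) by simp
  define B' where "B' = map (\<lambda>x. x - m) B"
  have BB': "B = map ((+) m) B'"
    unfolding B'_def map_map using B_gt[THEN less_imp_le] by (intro map_idI[symmetric]) auto
  have lenB: "length B' = N - 1 - m"
    using distinct_card[OF dist(2)] sets(2) by (simp add: B'_def)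
  show thesis
  proof (rule that)
    have "good (A @ D)"
      by (rule good_subseq[OF p(3)]) (auto simp: AR R intro: list_emb_append_mono)
    thus "(A, D) \<in> marked_low"
      using sets(1) dist(1) \<open>decr D\<close> m m_notin by (simp add: marked_low_def avoiders_iff)
    have "good B"
      by (rule good_subseq[OF p(3)]) (auto simp: AR R)
    hence "good B'" by (simp add: BB')
    moreover have "distinct B'" using dist(2) by (simp add: BB' distinct_map)
    moreover have "set B' = {1..length B'}"
    proof -
      have "set B' = (\<lambda>x. x - m) ` {m+1..N-1}" by (simp add: B'_def sets(2))
      also have "\<dots> = {1..N-1-m}"
      proof (intro equalityI subsetI)
        fix x assume "x \<in> {1..N-1-m}"
        thus "x \<in> (\<lambda>x. x - m) ` {m+1..N-1}" by (intro image_eqI[of _ _ "x + m"]) auto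
      qed auto
      finally show ?thesis by (simp add: lenB)
    qed
    ultimately show "B' \<in> avoiders" by (simp add: avoiders_iff)
    have "m + length B' + 1 = N" using lenB \<open>m < N\<close> by simp
    thus "p = ins (A, D) B'"
      by (simp add: ins_def m AR R flip: BB')
  qed
qed

text \<open>The position of the maximum \<open>N\<close> separates \<open>A\<close> from the rest.
  Since \<open>marked_low\<close> keeps the maximum \<open>m\<close> of \<open>A @ D\<close> out of
  \<open>D\<close>, \<open>m\<close> is recovered as the largest entry of \<open>A\<close>, and the
  length \<open>N - 1 - m\<close> of \<open>B\<close> then separates \<open>B\<close> from
  \<open>D\<close>.\<close>

lemma ins_inject:
  assumes "(A, D) \<in> marked_low" "B \<in> avoiders" "(A', D') \<in> marked_low" "B' \<in> avoiders"
    and ins_eq: "ins (A, D) B = ins (A', D') B'"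
  shows "A = A' \<and> D = D' \<and> B = B'"
proof -
  note eq = ins_eq[unfolded ins_def prod.case]
  define N where "N = length A + length D + length B + 1"
  have N': "N = length A' + length D' + length B' + 1"
    using arg_cong[OF eq, of length] by (simp add: N_def)
  have set: "set A \<union> set D = {1..length A + length D}" if "(A, D) \<in> marked_low" for A D
    using that by (auto simp: marked_low_def avoiders_iff)
  have "N \<notin> set A \<union> set D" unfolding set[OF assms(1)] N_def by simp
  moreover have "N \<notin> set (map ((+) (length A + length D)) B)"
    using assms(2) by (subst set_map_plus) (auto simp: avoiders_iff N_def)
  ultimately have notin: "N \<notin> set A" "N \<notin> set (map ((+) (length A + length D)) B @ D)"
    by simp_all
  have AR: "A = A' \<and> map ((+) (length A + length D)) B @ D = map ((+) (length A' + length D')) B' @ D'"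
    using eq unfolding N_def[symmetric] N'[symmetric] append_Cons_eq_iff[OF notin] .
  have Max: "length A + length D = Max (insert 0 (set A))" if AD: "(A, D) \<in> marked_low" for A D
  proof (rule sym, rule Max_eqI)
    have "length A + length D = 0 \<or> length A + length D \<in> set A \<union> set D"
      unfolding set[OF AD] by (cases "length A + length D") auto
    thus "length A + length D \<in> insert 0 (set A)"
      using AD by (auto simp: marked_low_def)
    show "x \<le> length A + length D" if "x \<in> insert 0 (set A)" for x
    proof -
      have "x = 0 \<or> x \<in> set A \<union> set D" using that by blast
      thus ?thesis unfolding set[OF AD] by auto
    qed
  qed simp
  have len: "length A + length D = length A' + length D'"
    using Max[OF assms(1)] Max[OF assms(3)] AR by simp
  hence "length B = length B'"
    using N' unfolding N_def by simp
  with AR len have "map ((+) (length A + length D)) B = map ((+) (length A + length D)) B'" "D = D'"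
    by (simp_all add: append_eq_append_conv)
  thus ?thesis
    using AR by (simp add: inj_map_eq_map)
qed

lemma length_ins [simp]: "length (ins (A, D) B) = length A + length D + length B + 1"
  by (simp add: ins_def)

lemma marked_low_subset_marked: "marked_low \<subseteq> marked"
  by (auto simp: marked_low_def marked_def)

lemma Nil_in_avoiders: "[] \<in> avoiders"
  by (auto simp: avoiders_iff good_def)

section \<open>Recursive structure of marked avoiders\<close>

definition marked_pos :: "(nat list \<times> nat list) set" where
  "marked_pos = {(A, D) \<in> marked. D \<noteq> []}"

definition mark :: "'a list \<Rightarrow> nat \<Rightarrow> 'a list \<times> 'a list" where
  "mark p i = (take (length p - i) p, drop (length p - i) p)"

lemma mark_append [simp]: "mark (A @ D) (length D) = (A, D)"
  by (simp add: mark_def)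

text \<open>Reduces injectivity and disjointness of the constructions on marked pairs to the
  underlying list and the suffix length.\<close>

lemma mark_eq_iff:
  assumes "i \<le> length p" "j \<le> length q"
  shows "mark p i = mark q j \<longleftrightarrow> p = q \<and> i = j"
proof
  assume *: "mark p i = mark q j"
  have "p = fst (mark p i) @ snd (mark p i)" "q = fst (mark q j) @ snd (mark q j)"
    "length (snd (mark p i)) = i" "length (snd (mark q j)) = j"
    using assms by (simp_all add: mark_def)
  with * show "p = q \<and> i = j" by metis
qed auto

lemma set_marked_low: "(A, D) \<in> marked_low \<Longrightarrow> set A \<union> set D = {1..length A + length D}"
  by (auto simp: marked_low_def avoiders_iff)

lemma ins_eq_iff:
  assumes "x \<in> marked_low" "B \<in> avoiders" "x' \<in> marked_low" "B' \<in> avoiders"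
  shows "ins x B = ins x' B' \<longleftrightarrow> x = x' \<and> B = B'"
proof
  obtain A D A' D' where x: "x = (A, D)" "x' = (A', D')" by (cases x; cases x')
  assume "ins x B = ins x' B'"
  thus "x = x' \<and> B = B'"
    using ins_inject[of A D B A' D' B'] assms unfolding x by blast
qed auto

lemma avoiders_eq: "avoiders = insert [] ((\<lambda>(x, B). ins x B) ` (marked_low \<times> avoiders))"
proof (intro equalityI subsetI)
  fix p assume "p \<in> avoiders"
  show "p \<in> insert [] ((\<lambda>(x, B). ins x B) ` (marked_low \<times> avoiders))"
  proof (cases "p = []")
    case False
    obtain A D B where "(A, D) \<in> marked_low" "B \<in> avoiders" "p = ins (A, D) B"
      using avoiders_decompose[OF \<open>p \<in> avoiders\<close> False] by blast
    hence "p = (\<lambda>(x, B). ins x B) ((A, D), B)" "((A, D), B) \<in> marked_low \<times> avoiders" by simp_all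
    thus ?thesis by blast
  qed auto
next
  fix p assume "p \<in> insert [] ((\<lambda>(x, B). ins x B) ` (marked_low \<times> avoiders))"
  then consider "p = []" | A D B where "p = ins (A, D) B" "(A, D) \<in> marked_low" "B \<in> avoiders" by auto
  thus "p \<in> avoiders"
  proof cases
    case 2
    thus ?thesis using marked_low_subset_marked by (auto intro: ins_in_avoiders)
  qed (simp add: Nil_in_avoiders)
qed

lemma mark_short:
  assumes "i \<le> length D"
  shows "mark (A @ D) i = (A @ take (length D - i) D, drop (length D - i) D)"
  using assms by (simp add: mark_def)

text \<open>Split the underlying avoider as \<open>ins (A, D) B\<close>. As the marked suffix misses
  the maximum, it starts to the right of it: either it is a suffix of \<open>D\<close>, of any
  length \<open>i\<close> (first image), or it is \<open>D\<close> preceded by a nonempty decreasing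
  suffix \<open>G\<close> of \<open>B = E @ G\<close> (second image). The latter decreases because
  the shifted \<open>B\<close> lies above \<open>D\<close>.\<close>

lemma marked_low_eq:
  "marked_low = insert ([], [])
     ((\<lambda>(((A, D), B), i). mark (ins (A, D) B) i) ` (SIGMA ((A, D), B):marked_low \<times> avoiders. {..length D}) \<union>
      (\<lambda>((A, D), (E, G)). mark (ins (A, D) (E @ G)) (length D + length G)) ` (marked_low \<times> marked_pos))"
  (is "_ = insert _ (?f ` ?X \<union> ?g ` ?Y)")
proof (intro equalityI subsetI)
  fix x assume x: "x \<in> marked_low"
  obtain A0 D0 where x_eq: "x = (A0, D0)" by (cases x)
  show "x \<in> insert ([], []) (?f ` ?X \<union> ?g ` ?Y)"
  proof (cases "A0 @ D0 = []")
    case False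
    have "A0 @ D0 \<in> avoiders" using x x_eq by (simp add: marked_low_def)
    from avoiders_decompose[OF this False] obtain A D B where ADB: "(A, D) \<in> marked_low" "B \<in> avoiders"
      and eq: "A0 @ D0 = ins (A, D) B" by blast
    define m where "m = length A + length D"
    define N where "N = m + length B + 1"
    have "length A0 + length D0 = N"
      using arg_cong[OF eq, of length] by (simp add: N_def m_def)
    hence "N \<notin> set D0" using x x_eq by (simp add: marked_low_def)
    have eq': "A0 @ D0 = (A @ [N]) @ map ((+) m) B @ D"
      using eq by (simp add: ins_def N_def m_def)
    obtain us where us: "A0 = A @ [N] @ us \<and> us @ D0 = map ((+) m) B @ D"
    proof -
      from eq' obtain us where
        "A0 = (A @ [N]) @ us \<and> us @ D0 = map ((+) m) B @ D \<or>
         A0 @ us = A @ [N] \<and> D0 = us @ map ((+) m) B @ D"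
        unfolding append_eq_append_conv2[of A0 D0] by blast
      thus thesis
      proof
        \<comment> \<open>In this case a nonempty \<open>us\<close> would end with \<open>N\<close>,
          which \<open>D0\<close> does not contain.\<close>
        assume *: "A0 @ us = A @ [N] \<and> D0 = us @ map ((+) m) B @ D"
        hence "us = []"
          using \<open>N \<notin> set D0\<close> by (cases us rule: rev_cases) auto
        thus thesis using * that[of "[]"] by simp
      qed (use that[of us] in simp)
    qed
    from us obtain vs where "us = map ((+) m) B @ vs \<and> vs @ D0 = D \<or>
        us @ vs = map ((+) m) B \<and> D0 = vs @ D"
      unfolding append_eq_append_conv2[of us D0] by blast
    \<comment> \<open>An empty \<open>vs\<close> means that the suffix is exactly \<open>D\<close>.
      This is assigned to the first case, which is why \<open>marked_pos\<close> requires a nonempty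
      suffix.\<close>
    hence "length D0 \<le> length D \<or> (vs \<noteq> [] \<and> us @ vs = map ((+) m) B \<and> D0 = vs @ D)"
      by auto
    thus ?thesis
    proof
      assume "length D0 \<le> length D"
      moreover have "x = mark (ins (A, D) B) (length D0)"
        by (simp add: x_eq flip: eq)
      ultimately have "x \<in> ?f ` ?X"
        using ADB by (intro image_eqI[of _ _ "(((A, D), B), length D0)"]) auto
      thus ?thesis by blast
    next
      assume *: "vs \<noteq> [] \<and> us @ vs = map ((+) m) B \<and> D0 = vs @ D"
      then obtain E G where EG: "B = E @ G" "vs = map ((+) m) G"
        by (metis map_eq_append_conv)
      have "decr D0" using x x_eq by (simp add: marked_low_def)
      hence "decr G" using * EG by (simp add: sorted_wrt_append sorted_wrt_map)
      hence "(E, G) \<in> marked_pos" using ADB(2) EG * by (auto simp: marked_pos_def marked_def)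
      moreover have "x = mark (ins (A, D) B) (length D0)"
        by (simp add: x_eq flip: eq)
      ultimately have "x \<in> ?g ` ?Y"
        using ADB * EG by (intro image_eqI[of _ _ "((A, D), (E, G))"]) (auto simp: add.commute)
      thus ?thesis by blast
    qed
  qed (auto simp: x_eq)
next
  fix x assume "x \<in> insert ([], []) (?f ` ?X \<union> ?g ` ?Y)"
  then consider "x = ([], [])" | "x \<in> ?f ` ?X" | "x \<in> ?g ` ?Y" by blast
  thus "x \<in> marked_low"
  proof cases
    case 1
    thus ?thesis using Nil_in_avoiders by (simp add: marked_low_def)
  next
    case 2
    then obtain A D B i where ADB: "(A, D) \<in> marked_low" "B \<in> avoiders" "i \<le> length D"
      "x = mark (ins (A, D) B) i" by auto
    define m where "m = length A + length D"
    define N where "N = m + length B + 1"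
    have ins_eq: "ins (A, D) B = (A @ N # map ((+) m) B) @ D"
      by (simp add: ins_def N_def m_def)
    have x_eq: "x = (A @ N # map ((+) m) B @ take (length D - i) D, drop (length D - i) D)"
      unfolding ADB(4) ins_eq mark_short[OF ADB(3)] by simp
    have "decr D" using ADB(1) by (simp add: marked_low_def)
    hence "decr (drop (length D - i) D)" by (rule sorted_wrt_drop)
    moreover have "N \<notin> set (drop (length D - i) D)"
    proof
      assume "N \<in> set (drop (length D - i) D)"
      hence "N \<in> set A \<union> set D" by (auto dest: in_set_dropD)
      thus False unfolding set_marked_low[OF ADB(1)] by (simp add: N_def m_def)
    qed
    moreover have "length A + length B + length D + 1 = N"
      by (simp add: N_def m_def)
    moreover have "ins (A, D) B \<in> avoiders" using ADB marked_low_subset_marked ins_in_avoiders by blast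
    ultimately show ?thesis using ADB(3) unfolding ins_eq
      by (simp add: marked_low_def x_eq add_ac)
  next
    case 3
    then obtain A D E G where AD: "(A, D) \<in> marked_low" and EG: "(E, G) \<in> marked_pos" and
      x: "x = mark (ins (A, D) (E @ G)) (length D + length G)" by auto
    have EG': "E @ G \<in> avoiders" "decr G" using EG by (auto simp: marked_pos_def marked_def)
    define m where "m = length A + length D"
    define N where "N = m + length (E @ G) + 1"
    have ins_eq: "ins (A, D) (E @ G) = (A @ N # map ((+) m) E) @ (map ((+) m) G @ D)"
      by (simp add: ins_def N_def m_def)
    have x_eq: "x = (A @ N # map ((+) m) E, map ((+) m) G @ D)"
      unfolding x ins_eq using mark_append[of "A @ N # map ((+) m) E" "map ((+) m) G @ D"]
      by (simp add: add.commute)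
    have D_le: "y \<le> m" if "y \<in> set D" for y
    proof -
      have "y \<in> set A \<union> set D" using that by simp
      thus ?thesis unfolding set_marked_low[OF AD] by (simp add: m_def)
    qed
    have G_bds: "1 \<le> y \<and> y \<le> length (E @ G)" if "y \<in> set G" for y
    proof -
      have "y \<in> set (E @ G)" using that by simp
      thus ?thesis using EG'(1) by (auto simp: avoiders_iff)
    qed
    have "decr D" using AD by (simp add: marked_low_def)
    hence "decr (map ((+) m) G @ D)"
      using EG'(2) D_le G_bds by (fastforce simp: sorted_wrt_append sorted_wrt_map)
    moreover have "N \<notin> set (map ((+) m) G @ D)"
      using D_le[of N] G_bds by (fastforce simp: N_def)
    moreover have "ins (A, D) (E @ G) \<in> avoiders" using AD EG' marked_low_subset_marked ins_in_avoiders by blast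
    moreover have "length (A @ N # map ((+) m) E) + length (map ((+) m) G @ D) = N"
      by (simp add: N_def m_def)
    ultimately show ?thesis unfolding ins_eq x_eq marked_low_def by simp
  qed
qed

lemma rev_upt_in_avoiders: "rev [1..<Suc j] \<in> avoiders"
proof -
  have decr: "decr (rev [1..<Suc j])"
    by (simp add: sorted_wrt_rev del: upt_Suc)
  have "good (rev [1..<Suc j])" unfolding good_def
  proof (intro allI impI)
    fix a b c d assume "subseq [a, b, c, d] (rev [1..<Suc j])" "c < d"
    with decr_subseq[OF decr this(1)] show False by simp
  qed
  thus ?thesis by (auto simp: avoiders_iff simp del: upt_Suc)
qed

text \<open>If the maximum lies in the marked decreasing suffix, it is its first entry. Everything
  after the maximum then decreases, so the block \<open>B\<close> is the decreasing permutation of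
  some length \<open>j\<close>, and the suffix consists of the maximum, the shifted \<open>B\<close>
  and \<open>D\<close>.\<close>

lemma marked_eq:
  "marked = marked_low \<union> (\<lambda>((A, D), j). mark (ins (A, D) (rev [1..<Suc j])) (length D + j + 1)) ` (marked_low \<times> UNIV)"
  (is "_ = marked_low \<union> ?f ` _")
proof (intro equalityI subsetI)
  fix x assume x: "x \<in> marked"
  obtain A0 D0 where x_eq: "x = (A0, D0)" by (cases x)
  have AD0: "A0 @ D0 \<in> avoiders" and "decr D0" using x x_eq by (auto simp: marked_def)
  show "x \<in> marked_low \<union> ?f ` (marked_low \<times> UNIV)"
  proof (cases "length A0 + length D0 \<in> set D0")
    case True
    define N where "N = length A0 + length D0"
    have "A0 @ D0 \<noteq> []" using True by auto
    from avoiders_decompose[OF AD0 this] obtain A D B where ADB: "(A, D) \<in> marked_low" "B \<in> avoiders"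
      and eq: "A0 @ D0 = ins (A, D) B" by blast
    define m where "m = length A + length D"
    have N: "N = m + length B + 1"
      using arg_cong[OF eq, of length] by (simp add: N_def m_def)
    obtain Y Z where D0: "D0 = Y @ N # Z"
      using True unfolding N_def by (meson split_list)
    have "Y = []"
    proof (cases Y)
      case (Cons y Y')
      hence "y > N" using \<open>decr D0\<close> D0 by simp
      have "y \<in> set (A0 @ D0)" using D0 Cons by simp
      moreover have "set (A0 @ D0) = {1..length (A0 @ D0)}" using AD0 by (simp only: avoiders_iff)
      ultimately have "y \<le> N" unfolding N_def by auto
      with \<open>y > N\<close> show ?thesis by simp
    qed
    have "A0 @ N # Z = A @ N # map ((+) m) B @ D"
      using eq D0 \<open>Y = []\<close> N by (simp add: ins_def m_def)
    moreover have "N \<notin> set A0" "N \<notin> set Z"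
      using AD0 D0 \<open>Y = []\<close> by (auto simp: avoiders_iff)
    ultimately have A: "A = A0" "map ((+) m) B @ D = Z"
      using append_Cons_eq_iff[of N A0 Z A "map ((+) m) B @ D"] by auto
    have "decr (map ((+) m) B)"
      using \<open>decr D0\<close> unfolding D0 A(2)[symmetric] by (simp add: sorted_wrt_append)
    hence "decr B" by (simp add: sorted_wrt_map)
    hence "sorted_wrt (\<ge>) B" by (rule sorted_wrt_mono_rel[rotated]) auto
    hence "sorted (rev B)" by (simp add: sorted_wrt_rev)
    moreover have "distinct (rev B)" using ADB(2) by (simp add: avoiders_iff)
    moreover have "set (rev B) = set [1..<Suc (length B)]"
      using ADB(2) unfolding avoiders_iff set_rev set_upt atLeastLessThanSuc_atLeastAtMost by blast
    ultimately have "rev B = [1..<Suc (length B)]"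
      by (intro sorted_distinct_set_unique sorted_upt distinct_upt)
    hence B: "B = rev [1..<Suc (length B)]" by (metis rev_rev_ident)
    have "x = mark (ins (A, D) B) (length D0)"
      by (simp add: x_eq flip: eq)
    moreover have "length D0 = length D + length B + 1"
      by (simp add: D0 \<open>Y = []\<close> flip: A(2))
    ultimately have "x = ?f ((A, D), length B)"
      using B by simp
    thus ?thesis using ADB by blast
  qed (use AD0 \<open>decr D0\<close> in \<open>auto simp: marked_low_def x_eq\<close>)
next
  fix x assume "x \<in> marked_low \<union> ?f ` (marked_low \<times> UNIV)"
  thus "x \<in> marked"
  proof
    assume "x \<in> ?f ` (marked_low \<times> UNIV)"
    then obtain A D j where AD: "(A, D) \<in> marked_low" and
      x: "x = mark (ins (A, D) (rev [1..<Suc j])) (length D + j + 1)" by auto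
    define B where "B = rev [1..<Suc j]"
    have B: "B \<in> avoiders" "decr B" "length B = j" "set B = {1..j}"
      using rev_upt_in_avoiders[of j] by (auto simp: B_def sorted_wrt_rev simp del: upt_Suc)
    define m where "m = length A + length D"
    define N where "N = m + j + 1"
    have ins_eq: "ins (A, D) B = A @ (N # map ((+) m) B @ D)"
      using B by (simp add: ins_def N_def m_def)
    have x_eq: "x = (A, N # map ((+) m) B @ D)"
      unfolding x B_def[symmetric] ins_eq using mark_append[of A "N # map ((+) m) B @ D"] B(3)
      by (simp add: add_ac)
    have D_le: "y \<le> m" if "y \<in> set D" for y
    proof -
      have "y \<in> set A \<union> set D" using that by simp
      thus ?thesis unfolding set_marked_low[OF AD] by (simp add: m_def)
    qed
    have "decr D" using AD by (simp add: marked_low_def)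
    hence "decr (N # map ((+) m) B @ D)"
      using B D_le by (fastforce simp: sorted_wrt_append sorted_wrt_map N_def)
    moreover have "ins (A, D) B \<in> avoiders" using AD B marked_low_subset_marked ins_in_avoiders by blast
    ultimately show "x \<in> marked" unfolding ins_eq x_eq marked_def by simp
  qed (use marked_low_subset_marked in auto)
qed

section \<open>The functional equation\<close>

abbreviation total :: "nat list \<times> nat list \<Rightarrow> nat" where
  "total \<equiv> (\<lambda>(A, D). length A + length D)"

abbreviation avoiders_gf :: "rat fps" where
  "avoiders_gf \<equiv> gf avoiders length (\<lambda>_. 1)"

definition marked_gf :: "rat fps \<Rightarrow> rat fps" where
  "marked_gf u = gf marked_low total (\<lambda>(A, D). u ^ length D)"

lemma locally_finite_avoiders: "locally_finite avoiders length"
  unfolding locally_finite_def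
proof
  fix N
  have "{p \<in> avoiders. length p \<le> N} \<subseteq> {xs. set xs \<subseteq> {0..N} \<and> length xs \<le> N}"
    by (auto simp: avoiders_iff)
  thus "finite {p \<in> avoiders. length p \<le> N}"
    using finite_lists_length_le[of "{0..N}" N] finite_subset by blast
qed

lemma locally_finite_marked: "locally_finite marked total"
proof -
  have "locally_finite ((\<lambda>(p, i). mark p i) ` (SIGMA p:avoiders. {..length p})) total"
    by (rule locally_finite_image[OF locally_finite_Sigma[OF locally_finite_avoiders]]) (auto simp: mark_def)
  moreover have "marked \<subseteq> (\<lambda>(p, i). mark p i) ` (SIGMA p:avoiders. {..length p})"
  proof
    fix x assume "x \<in> marked"
    then obtain A D where "x = mark (A @ D) (length D)" "A @ D \<in> avoiders" by (auto simp: marked_def)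
    thus "x \<in> (\<lambda>(p, i). mark p i) ` (SIGMA p:avoiders. {..length p})"
      by (intro image_eqI[of _ _ "(A @ D, length D)"]) auto
  qed
  ultimately show ?thesis by (rule locally_finite_subset)
qed

lemma locally_finite_marked_low: "locally_finite marked_low total"
  using locally_finite_marked marked_low_subset_marked by (rule locally_finite_subset)

lemma locally_finite_marked_pos: "locally_finite marked_pos total"
  using locally_finite_marked by (rule locally_finite_subset) (auto simp: marked_pos_def)

lemma avoiders_gf_eq: "avoiders_gf = 1 + fps_X * marked_gf 1 * avoiders_gf"
proof -
  let ?f = "\<lambda>(x, B). ins x B"
  have VS: "locally_finite (marked_low \<times> avoiders) (\<lambda>(x, B). total x + length B)"
    by (rule locally_finite_Times[OF locally_finite_marked_low locally_finite_avoiders])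
  have image: "gf (?f ` (marked_low \<times> avoiders)) length (\<lambda>_. 1) =
      fps_X ^ 1 * 1 * gf (marked_low \<times> avoiders) (\<lambda>(x, B). total x + length B) (\<lambda>(x, B). 1 * 1)"
    by (rule gf_image[OF VS]) (auto simp: inj_on_def ins_eq_iff)
  have lf: "locally_finite (?f ` (marked_low \<times> avoiders)) length"
    by (rule locally_finite_image[OF VS]) auto
  have "avoiders_gf = gf ({[]} \<union> ?f ` (marked_low \<times> avoiders)) length (\<lambda>_. 1)"
    by (rule arg_cong[where f = "\<lambda>X. gf X length (\<lambda>_. 1)", OF trans[OF avoiders_eq insert_is_Un]])
  also have "\<dots> = gf {[] :: nat list} length (\<lambda>_. 1) + gf (?f ` (marked_low \<times> avoiders)) length (\<lambda>_. 1)"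
    by (rule gf_Un[OF locally_finite_singleton lf]) (auto simp: ins_def)
  also have "\<dots> = 1 + fps_X * gf (marked_low \<times> avoiders) (\<lambda>(x, B). total x + length B) (\<lambda>(x, B). 1 * 1)"
    unfolding image gf_singleton by simp
  also have "gf (marked_low \<times> avoiders) (\<lambda>(x, B). total x + length B) (\<lambda>(x, B). 1 * 1) = marked_gf 1 * avoiders_gf"
    unfolding gf_Times[OF locally_finite_marked_low locally_finite_avoiders] marked_gf_def by (simp add: case_prod_unfold)
  finally show ?thesis unfolding mult.assoc .
qed

text \<open>Translates \<open>marked_low_eq\<close>; the suffixes of \<open>D\<close> contribute a
  geometric sum in \<open>u\<close>. The factor \<open>1 - u\<close> clears its denominator, since
  \<open>u\<close> will have constant term 1 and \<open>1 - u\<close> is then no unit.\<close>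

lemma marked_gf_eq:
  "(1 - u) * marked_gf u = (1 - u) + fps_X * avoiders_gf * (marked_gf 1 - u * marked_gf u) +
     (1 - u) * fps_X * marked_gf u * gf marked_pos total (\<lambda>(A, D). u ^ length D)"
proof -
  let ?f = "\<lambda>(((A, D), B), i). mark (ins (A, D) B) i"
  let ?X = "SIGMA ((A, D), B):marked_low \<times> avoiders. {..length D}"
  let ?g = "\<lambda>((A, D), (E, G)). mark (ins (A, D) (E @ G)) (length D + length G)"
  let ?w = "\<lambda>(A :: nat list, D :: nat list). u ^ length D"
  let ?t = "\<lambda>(x, B :: nat list). total x + length B"
  let ?G = "gf (marked_low \<times> avoiders) ?t (\<lambda>((A, D), B). \<Sum>i\<le>length D. u ^ i)"
  have VS: "locally_finite (marked_low \<times> avoiders) ?t"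
    by (rule locally_finite_Times[OF locally_finite_marked_low locally_finite_avoiders])
  have X: "locally_finite ?X (\<lambda>(y, i). ?t y)"
    by (rule locally_finite_Sigma[OF VS]) auto
  have VR: "locally_finite (marked_low \<times> marked_pos) (\<lambda>(x, y). total x + total y)"
    by (rule locally_finite_Times[OF locally_finite_marked_low locally_finite_marked_pos])
  have RS: "E @ G \<in> avoiders" if "(E, G) \<in> marked_pos" for E G
    using that by (auto simp: marked_pos_def marked_def)
  have inj_f: "inj_on ?f ?X"
  proof (rule inj_onI)
    fix y y' assume *: "y \<in> ?X" "y' \<in> ?X" "?f y = ?f y'"
    obtain A D B i A' D' B' i' where y: "y = (((A, D), B), i)" "y' = (((A', D'), B'), i')"
      by (metis prod.exhaust)
    from * show "y = y'"
      unfolding y by (auto simp: mark_eq_iff ins_eq_iff)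
  qed
  have inj_g: "inj_on ?g (marked_low \<times> marked_pos)"
  proof (rule inj_onI)
    fix y y' assume y: "y \<in> marked_low \<times> marked_pos" "y' \<in> marked_low \<times> marked_pos" "?g y = ?g y'"
    obtain A D E G A' D' E' G' where y_eq: "y = ((A, D), (E, G))" "y' = ((A', D'), (E', G'))"
      by (metis prod.exhaust)
    from y have "(A, D) \<in> marked_low" "(E, G) \<in> marked_pos" "(A', D') \<in> marked_low" "(E', G') \<in> marked_pos"
      and "mark (ins (A, D) (E @ G)) (length D + length G) =
           mark (ins (A', D') (E' @ G')) (length D' + length G')"
      unfolding y_eq by auto
    hence "(A, D) = (A', D') \<and> E @ G = E' @ G'" "length D + length G = length D' + length G'"
      by (auto simp add: mark_eq_iff ins_eq_iff RS)
    thus "y = y'" unfolding y_eq by auto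
  qed
  have disj: "?f ` ?X \<inter> ?g ` (marked_low \<times> marked_pos) = {}"
  proof (rule equals0I)
    fix y assume "y \<in> ?f ` ?X \<inter> ?g ` (marked_low \<times> marked_pos)"
    then obtain A D B i A' D' E G where *: "(A, D) \<in> marked_low" "B \<in> avoiders" "i \<le> length D"
      "(A', D') \<in> marked_low" "(E, G) \<in> marked_pos" "y = mark (ins (A, D) B) i"
      "y = mark (ins (A', D') (E @ G)) (length D' + length G)" by auto
    hence "mark (ins (A, D) B) i = mark (ins (A', D') (E @ G)) (length D' + length G)" by simp
    hence "ins (A, D) B = ins (A', D') (E @ G)" "i = length D' + length G"
      using * by (simp_all add: mark_eq_iff)
    moreover from this have "(A, D) = (A', D')"
      using * RS by (simp add: ins_eq_iff)
    ultimately have "G = []" using * by simp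
    thus False using * by (simp add: marked_pos_def)
  qed
  have gf_f: "gf (?f ` ?X) total ?w = fps_X ^ 1 * 1 * gf ?X (\<lambda>(y, i). ?t y) (\<lambda>(y, i). u ^ i)"
    by (rule gf_image[OF X inj_f]) (auto simp: mark_def)
  have gf_g: "gf (?g ` (marked_low \<times> marked_pos)) total ?w =
      fps_X ^ 1 * 1 * gf (marked_low \<times> marked_pos) (\<lambda>(x, y). total x + total y) (\<lambda>(x, y). ?w x * ?w y)"
    by (rule gf_image[OF VR inj_g]) (auto simp: mark_def power_add)
  have lf_f: "locally_finite (?f ` ?X) total"
    by (rule locally_finite_image[OF X]) (auto simp: mark_def)
  have lf_g: "locally_finite (?g ` (marked_low \<times> marked_pos)) total"
    by (rule locally_finite_image[OF VR]) (auto simp: mark_def)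
  have "([], []) \<notin> ?f ` ?X \<union> ?g ` (marked_low \<times> marked_pos)"
    by (auto simp: mark_def ins_def marked_pos_def)
  hence "{([], [])} \<inter> (?f ` ?X \<union> ?g ` (marked_low \<times> marked_pos)) = {}" by blast
  from gf_Un[OF locally_finite_singleton locally_finite_Un[OF lf_f lf_g] this]
  have gf_base: "gf ({([], [])} \<union> (?f ` ?X \<union> ?g ` (marked_low \<times> marked_pos))) total ?w =
      gf {([], [])} total ?w + gf (?f ` ?X \<union> ?g ` (marked_low \<times> marked_pos)) total ?w" .
  have "gf marked_low total ?w = gf ({([], [])} \<union> (?f ` ?X \<union> ?g ` (marked_low \<times> marked_pos))) total ?w"
    by (rule arg_cong[where f = "\<lambda>X. gf X total ?w", OF trans[OF marked_low_eq insert_is_Un]])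
  also note gf_base
  also have "gf (?f ` ?X \<union> ?g ` (marked_low \<times> marked_pos)) total ?w = gf (?f ` ?X) total ?w + gf (?g ` (marked_low \<times> marked_pos)) total ?w"
    by (rule gf_Un[OF lf_f lf_g disj])
  also have "gf (?f ` ?X) total ?w = fps_X * ?G"
  proof -
    have "gf ?X (\<lambda>(y, i). ?t y) (\<lambda>(y, i). u ^ i) = gf (marked_low \<times> avoiders) ?t (\<lambda>y. \<Sum>i\<in>(\<lambda>((A, D), B). {..length D}) y. u ^ i)"
      by (rule gf_Sigma[OF VS]) auto
    also have "\<dots> = ?G" by (rule gf_cong) auto
    finally show ?thesis unfolding gf_f by simp
  qed
  also have "gf (?g ` (marked_low \<times> marked_pos)) total ?w = fps_X * marked_gf u * gf marked_pos total ?w"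
    unfolding gf_g gf_Times[OF locally_finite_marked_low locally_finite_marked_pos] marked_gf_def by (simp add: mult.assoc)
  also have "gf {([], [])} total ?w = 1"
    by (simp add: gf_singleton)
  finally have *: "marked_gf u = 1 + (fps_X * ?G + fps_X * marked_gf u * gf marked_pos total ?w)"
    unfolding marked_gf_def[symmetric] .
  \<comment> \<open>Termwise, \<open>1 - u\<close> turns the geometric sum into
    \<open>1 - u * u ^ length D\<close>, which splits into the contributions of
    \<open>marked_gf 1\<close> and \<open>u * marked_gf u\<close>.\<close>
  have "(1 - u) * ?G = gf (marked_low \<times> avoiders) ?t (\<lambda>y. (1 - u) * (\<lambda>((A, D), B). \<Sum>i\<le>length D. u ^ i) y)"
    by (rule gf_mult_left[OF VS, symmetric])
  also have "\<dots> = gf (marked_low \<times> avoiders) ?t (\<lambda>y. (case y of (x, B) \<Rightarrow> (case x of (A, D) \<Rightarrow> 1 ^ length D) * 1) -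
      u * (case y of (x, B) \<Rightarrow> ?w x * 1))"
  proof (rule gf_cong)
    fix y assume "y \<in> marked_low \<times> avoiders"
    then obtain A D B where y: "y = ((A, D), B)" by (metis prod.exhaust)
    show "(1 - u) * (\<lambda>((A, D), B). \<Sum>i\<le>length D. u ^ i) y =
      (case y of (x, B) \<Rightarrow> (case x of (A, D) \<Rightarrow> 1 ^ length D) * 1) - u * (case y of (x, B) \<Rightarrow> ?w x * 1)"
      using sum_gp_basic[of u "length D"] by (simp add: y)
  qed auto
  also have "\<dots> = marked_gf 1 * avoiders_gf - u * (marked_gf u * avoiders_gf)"
    unfolding gf_diff gf_mult_left[OF VS] gf_Times[OF locally_finite_marked_low locally_finite_avoiders] marked_gf_def ..
  finally have G: "(1 - u) * ?G = marked_gf 1 * avoiders_gf - u * (marked_gf u * avoiders_gf)" .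
  have "(1 - u) * marked_gf u = (1 - u) + fps_X * ((1 - u) * ?G) + (1 - u) * fps_X * marked_gf u * gf marked_pos total ?w"
    by (subst *) (simp add: algebra_simps)
  also note G
  also have "(1 - u) + fps_X * (marked_gf 1 * avoiders_gf - u * (marked_gf u * avoiders_gf)) + (1 - u) * fps_X * marked_gf u * gf marked_pos total ?w =
      (1 - u) + fps_X * avoiders_gf * (marked_gf 1 - u * marked_gf u) + (1 - u) * fps_X * marked_gf u * gf marked_pos total ?w"
    by (simp add: algebra_simps)
  finally show ?thesis .
qed

text \<open>\<open>marked\<close> is counted in two ways: by \<open>marked_eq\<close>, where a
  geometric series in \<open>fps_X * u\<close> accounts for the inserted decreasing block, and by
  separating the empty suffixes, which contribute \<open>avoiders_gf\<close>. Multiplying by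
  \<open>1 - fps_X * u\<close> removes the geometric series.\<close>

lemma marked_pos_gf_eq:
  "(1 - fps_X * u) * (gf marked_pos total (\<lambda>(A, D). u ^ length D) + avoiders_gf - marked_gf u) = fps_X * u * marked_gf u"
proof -
  let ?f = "\<lambda>((A, D), j). mark (ins (A, D) (rev [1..<Suc j])) (length D + j + 1)"
  let ?w = "\<lambda>(A :: nat list, D :: nat list). u ^ length D"
  let ?G = "gf (UNIV :: nat set) (\<lambda>j. j) (\<lambda>j. u ^ j)"
  have lf_nat: "locally_finite X (\<lambda>j. j)" for X :: "nat set"
    unfolding locally_finite_def by (auto intro: finite_subset[of _ "{..N}" for N])
  have "?G = gf {0} (\<lambda>j. j) (\<lambda>j. u ^ j) + gf (range Suc) (\<lambda>j. j) (\<lambda>j. u ^ j)"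
  proof -
    have "UNIV = {0} \<union> range Suc" using not0_implies_Suc by auto
    moreover have "gf ({0} \<union> range Suc) (\<lambda>j. j) (\<lambda>j. u ^ j) =
        gf {0} (\<lambda>j. j) (\<lambda>j. u ^ j) + gf (range Suc) (\<lambda>j. j) (\<lambda>j. u ^ j)"
      by (rule gf_Un[OF lf_nat lf_nat]) auto
    ultimately show ?thesis by (simp only:)
  qed
  also have "gf (range Suc) (\<lambda>j. j) (\<lambda>j. u ^ j) = fps_X ^ 1 * u * ?G"
    by (rule gf_image[OF lf_nat]) auto
  finally have "?G - fps_X ^ 1 * u * ?G = gf {0} (\<lambda>j. j) (\<lambda>j. u ^ j)"
    unfolding diff_eq_eq .
  hence G: "(1 - fps_X * u) * ?G = 1"
    by (simp add: gf_singleton algebra_simps)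
  have V_nat: "locally_finite (marked_low \<times> UNIV) (\<lambda>(x, j). total x + j)"
    by (rule locally_finite_Times[OF locally_finite_marked_low lf_nat])
  have inj: "inj_on ?f (marked_low \<times> UNIV)"
  proof (rule inj_onI)
    fix y y' assume y: "y \<in> marked_low \<times> UNIV" "y' \<in> marked_low \<times> UNIV" "?f y = ?f y'"
    obtain A D j A' D' j' where y_eq: "y = ((A, D), j)" "y' = ((A', D'), j')"
      by (metis prod.exhaust)
    from y have "(A, D) \<in> marked_low" "(A', D') \<in> marked_low"
      "mark (ins (A, D) (rev [1..<Suc j])) (length D + j + 1) =
       mark (ins (A', D') (rev [1..<Suc j'])) (length D' + j' + 1)"
      unfolding y_eq by auto
    hence *: "ins (A, D) (rev [1..<Suc j]) = ins (A', D') (rev [1..<Suc j'])"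
      "length D + j + 1 = length D' + j' + 1"
      by (simp_all add: mark_eq_iff del: upt_Suc)
    hence "(A, D) = (A', D')"
      using ins_eq_iff[OF \<open>(A, D) \<in> marked_low\<close> rev_upt_in_avoiders \<open>(A', D') \<in> marked_low\<close> rev_upt_in_avoiders] by blast
    thus "y = y'" unfolding y_eq using * by simp
  qed
  have disj: "marked_low \<inter> ?f ` (marked_low \<times> UNIV) = {}"
    by (auto simp: marked_low_def mark_def ins_def simp del: upt_Suc)
  have "gf marked total ?w = marked_gf u + gf (?f ` (marked_low \<times> UNIV)) total ?w"
    unfolding marked_gf_def marked_eq
    by (rule gf_Un[OF locally_finite_marked_low _ disj])
       (rule locally_finite_image[OF V_nat], auto simp: mark_def simp del: upt_Suc)
  also have "gf (?f ` (marked_low \<times> UNIV)) total ?w =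
      fps_X ^ 1 * u * gf (marked_low \<times> UNIV) (\<lambda>(x, j). total x + j) (\<lambda>(x, j). ?w x * u ^ j)"
    by (rule gf_image[OF V_nat inj]) (auto simp: mark_def power_add simp del: upt_Suc)
  also have "gf (marked_low \<times> UNIV) (\<lambda>(x, j). total x + j) (\<lambda>(x, j). ?w x * u ^ j) = marked_gf u * ?G"
    unfolding gf_Times[OF locally_finite_marked_low lf_nat] marked_gf_def ..
  finally have T1: "gf marked total ?w = marked_gf u + fps_X * u * marked_gf u * ?G" by (simp add: mult.assoc)
  have "marked = marked_pos \<union> (\<lambda>p. (p, [])) ` avoiders"
    by (auto simp: marked_pos_def marked_def)
  moreover have "gf (marked_pos \<union> (\<lambda>p. (p, [])) ` avoiders) total ?w = gf marked_pos total ?w + gf ((\<lambda>p. (p, [])) ` avoiders) total ?w"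
    by (rule gf_Un[OF locally_finite_marked_pos locally_finite_image[OF locally_finite_avoiders]]) (auto simp: marked_pos_def)
  moreover have "gf ((\<lambda>p. (p, [])) ` avoiders) total ?w = fps_X ^ 0 * 1 * avoiders_gf"
    by (rule gf_image[OF locally_finite_avoiders]) (auto simp: inj_on_def)
  ultimately have "gf marked total ?w = gf marked_pos total ?w + avoiders_gf" by simp
  with T1 have "(1 - fps_X * u) * (gf marked_pos total ?w + avoiders_gf - marked_gf u) = fps_X * u * marked_gf u * ((1 - fps_X * u) * ?G)"
    by (simp add: algebra_simps)
  thus ?thesis unfolding G by simp
qed

theorem marked_gf_quadratic:
  "fps_X * (1 - u) * (marked_gf u)\<^sup>2 - (1 - fps_X * u) * (fps_X * avoiders_gf + 1 - u) * marked_gf u + (1 - fps_X * u) * (avoiders_gf - u) = 0"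
  (is "?Q = 0")
proof -
  define r where "r = gf marked_pos total (\<lambda>(A, D). u ^ length D)"
  \<comment> \<open>This combination of the three preceding equations eliminates
    \<open>marked_gf 1\<close> and the series \<open>r\<close> of nonempty suffixes.\<close>
  have "?Q = - (1 - fps_X * u) * ((1 - u) * marked_gf u - ((1 - u) + fps_X * avoiders_gf * (marked_gf 1 - u * marked_gf u) + (1 - u) * fps_X * marked_gf u * r))
     - (1 - u) * fps_X * marked_gf u * ((1 - fps_X * u) * (r + avoiders_gf - marked_gf u) - fps_X * u * marked_gf u)
     + (1 - fps_X * u) * (avoiders_gf - (1 + fps_X * marked_gf 1 * avoiders_gf))"
    by algebra
  also have "\<dots> = 0"
    using avoiders_gf_eq marked_gf_eq[of u] marked_pos_gf_eq[of u] unfolding r_def by simp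
  finally show ?thesis .
qed

lemma class_gf_avoiders: "class_gf avoiders = avoiders_gf"
proof (rule fps_ext)
  fix n
  have fin: "finite {p \<in> avoiders. length p \<le> n}"
    using locally_finite_avoiders by (rule locally_finiteD)
  have "avoiders_gf $ n = (\<Sum>p | p \<in> avoiders \<and> length p \<le> n. if length p = n then 1 else 0)"
    unfolding gf_def fps_nth_Abs_fps fps_sum_nth by (intro sum.cong) auto
  also have "\<dots> = of_nat (card {p \<in> avoiders. length p = n})"
    using fin by (subst sum.If_cases) (auto intro!: arg_cong[of _ _ card])
  finally show "class_gf avoiders $ n = avoiders_gf $ n"
    by (simp add: class_gf_def)
qed

section \<open>The quadratic method\<close>

text \<open>\<open>a - b\<close> divides \<open>a ^ k - b ^ k\<close>, so each weight, and with it
  the whole series, moves no further than its argument.\<close>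

lemma marked_gf_cong:
  assumes "fps_X ^ n dvd a - b"
  shows "fps_X ^ n dvd marked_gf a - marked_gf b"
  unfolding marked_gf_def
proof (rule gf_dvd_diff)
  fix x :: "nat list \<times> nat list"
  have "a - b dvd a ^ length (snd x) - b ^ length (snd x)"
    by (simp add: power_diff_sumr2)
  thus "fps_X ^ n dvd (case x of (A, D) \<Rightarrow> a ^ length D) - (case x of (A, D) \<Rightarrow> b ^ length D)"
    using assms by (auto simp: case_prod_unfold intro: dvd_trans)
qed

text \<open>The expression is the discriminant of the cubic; the second hypothesis is the vanishing
  of its derivative, which makes \<open>x\<close> a double root.\<close>

lemma discriminant_eq_0:
  fixes a b c d x :: "'a::idom"
  assumes "a * x ^ 3 + b * x\<^sup>2 + c * x + d = 0" "3 * a * x\<^sup>2 + 2 * b * x + c = 0"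
  shows "b\<^sup>2 * c\<^sup>2 - 4 * a * c ^ 3 - 4 * b ^ 3 * d - 27 * a\<^sup>2 * d\<^sup>2 + 18 * a * b * c * d = 0"
  using assms by algebra

text \<open>
  With \<open>u = 1 - z w\<close>, the discriminant of the quadratic equation for \<open>marked_gf u\<close> is
  \<open>z\<^sup>2 (1 - z u)\<close> times \<open>kern_disc w\<close>, and its derivative with respect to \<open>marked_gf u\<close> is
  \<open>z\<close> times \<open>kern w\<close>.
\<close>

definition kern_disc :: "rat fps \<Rightarrow> rat fps" where
  "kern_disc w = (1 - fps_X + fps_X\<^sup>2 * w) * (w + avoiders_gf)\<^sup>2 - 4 * w * (avoiders_gf - 1 + fps_X * w)"

definition kern :: "rat fps \<Rightarrow> rat fps" where
  "kern w = 2 * fps_X * w * marked_gf (1 - fps_X * w) - (1 - fps_X + fps_X\<^sup>2 * w) * (w + avoiders_gf)"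

text \<open>Completing the square: if \<open>a * p\<^sup>2 + b * p + c = 0\<close>, then the square
  of \<open>2 * a * p + b\<close> is the discriminant \<open>b\<^sup>2 - 4 * a * c\<close>. The
  common factor \<open>fps_X\<^sup>2\<close> is cancelled at the end.\<close>

lemma kern_square: "(kern w)\<^sup>2 = (1 - fps_X + fps_X\<^sup>2 * w) * kern_disc w"
proof -
  define p where "p = marked_gf (1 - fps_X * w)"
  have "fps_X\<^sup>2 * ((kern w)\<^sup>2 - (1 - fps_X + fps_X\<^sup>2 * w) * kern_disc w) = 4 * fps_X\<^sup>2 * w *
    (fps_X * (1 - (1 - fps_X * w)) * p\<^sup>2
     - (1 - fps_X * (1 - fps_X * w)) * (fps_X * avoiders_gf + 1 - (1 - fps_X * w)) * p
     + (1 - fps_X * (1 - fps_X * w)) * (avoiders_gf - (1 - fps_X * w)))"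
    unfolding kern_def kern_disc_def p_def[symmetric] by algebra
  also have "\<dots> = 0"
    unfolding p_def marked_gf_quadratic by simp
  finally show ?thesis by simp
qed

lemma kern_cong:
  assumes "fps_X ^ n dvd a - b"
  shows "fps_X ^ n dvd kern a - kern b"
proof -
  have "fps_X ^ n dvd fps_X * (b - a)"
    using assms by (metis dvd_mult dvd_minus_iff minus_diff_eq)
  also have "fps_X * (b - a) = (1 - fps_X * a) - (1 - fps_X * b)"
    by (simp add: algebra_simps)
  finally have *: "fps_X ^ n dvd marked_gf (1 - fps_X * a) - marked_gf (1 - fps_X * b)"
    by (rule marked_gf_cong)
  have "kern a - kern b = (a - b) * (2 * fps_X * marked_gf (1 - fps_X * a) - (1 - fps_X + fps_X\<^sup>2 * (a + b + avoiders_gf)))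
      + 2 * fps_X * b * (marked_gf (1 - fps_X * a) - marked_gf (1 - fps_X * b))"
    unfolding kern_def by algebra
  thus ?thesis using * assms by simp
qed

text \<open>
  The second equation is the vanishing of the derivative of \<open>kern_disc\<close> at \<open>v\<close>. It is obtained without
  differentiating \<open>marked_gf\<close>: perturbing \<open>v\<close> by \<open>h = z ^ n\<close> changes \<open>kern\<close> by a multiple of \<open>h\<close>,
  so \<open>h\<^sup>2\<close> divides \<open>kern_disc (v + h)\<close>, and therefore \<open>h\<close> divides the derivative, for every \<open>n\<close>.
\<close>

lemma kern_disc_double_root:
  obtains v where "kern_disc v = 0"
    "3 * fps_X\<^sup>2 * v\<^sup>2 + 2 * (1 - 5 * fps_X + 2 * fps_X\<^sup>2 * avoiders_gf) * v +
      (2 * avoiders_gf * (1 - fps_X) + fps_X\<^sup>2 * avoiders_gf\<^sup>2 - 4 * avoiders_gf + 4) = 0"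
proof -
  \<comment> \<open>Modulo \<open>fps_X\<close>, \<open>kern v\<close> is
    \<open>- (v + avoiders_gf)\<close>. In \<open>kern v + v\<close> the unknown thus occurs only
    with a factor \<open>fps_X\<close>, which gives a contraction; the substitution
    \<open>u = 1 - z w\<close> arranges this.\<close>
  have "\<exists>v. kern v + v = v"
  proof -
    obtain v where "kern v + v = v"
    proof (rule fps_fixpoint[of "\<lambda>v. kern v + v"])
      fix a b :: "rat fps" and n
      assume "fps_X ^ n dvd a - b"
      moreover from this have "fps_X ^ n dvd fps_X * (b - a)"
        by (metis dvd_mult dvd_minus_iff minus_diff_eq)
      hence "fps_X ^ n dvd (1 - fps_X * a) - (1 - fps_X * b)"
        by (simp add: algebra_simps)
      hence "fps_X ^ n dvd marked_gf (1 - fps_X * a) - marked_gf (1 - fps_X * b)"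
        by (rule marked_gf_cong)
      ultimately obtain k l where kl: "a - b = fps_X ^ n * k"
        "marked_gf (1 - fps_X * a) - marked_gf (1 - fps_X * b) = fps_X ^ n * l"
        by (elim dvdE)
      have "(kern a + a) - (kern b + b) = fps_X * ((a - b) * (2 * marked_gf (1 - fps_X * a) + 1 - fps_X * (a + b + avoiders_gf))
        + 2 * b * (marked_gf (1 - fps_X * a) - marked_gf (1 - fps_X * b)))"
        unfolding kern_def by algebra
      also have "\<dots> = fps_X ^ Suc n * (k * (2 * marked_gf (1 - fps_X * a) + 1 - fps_X * (a + b + avoiders_gf)) + 2 * b * l)"
        unfolding kl by (simp add: algebra_simps)
      finally show "fps_X ^ Suc n dvd (kern a + a) - (kern b + b)" by simp
    qed
    thus ?thesis by blast
  qed
  then obtain v where v: "kern v = 0" by auto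
  define c where "c = 3 * fps_X\<^sup>2 * v\<^sup>2 + 2 * (1 - 5 * fps_X + 2 * fps_X\<^sup>2 * avoiders_gf) * v +
      (2 * avoiders_gf * (1 - fps_X) + fps_X\<^sup>2 * avoiders_gf\<^sup>2 - 4 * avoiders_gf + 4)"
  \<comment> \<open>Constant term 1 makes the factor between \<open>(kern w)\<^sup>2\<close> and
    \<open>kern_disc w\<close> invertible, so divisibility passes from one to the other.\<close>
  have unit: "is_unit (1 - fps_X + fps_X\<^sup>2 * w :: rat fps)" for w
    by simp
  have K0: "kern_disc v = 0"
  proof -
    have "1 - fps_X + fps_X\<^sup>2 * v \<noteq> 0" using unit[of v] by (metis not_is_unit_0)
    thus ?thesis using kern_square[of v] v by simp
  qed
  have "fps_X ^ n dvd c" for n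
  proof -
    let ?h = "fps_X ^ n :: rat fps"
    have "?h dvd (v + ?h) - v" by (simp only: add_diff_cancel_left' dvd_refl)
    hence "?h dvd kern (v + ?h) - kern v" by (rule kern_cong)
    hence hQ: "?h dvd kern (v + ?h)" unfolding v diff_0_right .
    have "?h * ?h dvd (kern (v + ?h))\<^sup>2"
      unfolding power2_eq_square by (rule mult_dvd_mono[OF hQ hQ])
    hence "?h * ?h dvd kern_disc (v + ?h)"
      unfolding kern_square using unit by (simp add: dvd_mult_unit_iff')
    moreover have "kern_disc (v + ?h) = kern_disc v + ?h * c + ?h * ?h * (1 - 5 * fps_X + 2 * fps_X\<^sup>2 * avoiders_gf + fps_X\<^sup>2 * (3 * v + ?h))"
      unfolding kern_disc_def c_def by algebra
    ultimately have "?h * ?h dvd ?h * c"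
      by (simp add: K0 dvd_add_left_iff)
    thus "?h dvd c" by simp
  qed
  hence "c = 0" by (rule fps_eq_0_if_X_powers_dvd)
  with K0 that[of v] show thesis unfolding c_def by blast
qed

theorem avoiders_gf_cubic:
  "fps_X ^ 4 * avoiders_gf ^ 3 + (5 * fps_X ^ 3 - 11 * fps_X ^ 2) * avoiders_gf ^ 2
      + (3 * fps_X ^ 2 + 10 * fps_X - 1) * avoiders_gf - 9 * fps_X + 1 = 0" (is "?M = 0")
proof -
  obtain v where v: "kern_disc v = 0" "3 * fps_X\<^sup>2 * v\<^sup>2 + 2 * (1 - 5 * fps_X + 2 * fps_X\<^sup>2 * avoiders_gf) * v +
      (2 * avoiders_gf * (1 - fps_X) + fps_X\<^sup>2 * avoiders_gf\<^sup>2 - 4 * avoiders_gf + 4) = 0"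
    by (rule kern_disc_double_root)
  \<comment> \<open>\<open>a\<close>, \<open>b\<close>, \<open>c\<close>, \<open>d\<close> are the
    coefficients of \<open>kern_disc\<close> as a cubic in its argument.\<close>
  define a :: "rat fps" where "a = fps_X\<^sup>2"
  define b where "b = 1 - 5 * fps_X + 2 * fps_X\<^sup>2 * avoiders_gf"
  define c where "c = 2 * avoiders_gf * (1 - fps_X) + fps_X\<^sup>2 * avoiders_gf\<^sup>2 - 4 * avoiders_gf + 4"
  define d where "d = (1 - fps_X) * avoiders_gf\<^sup>2"
  have "kern_disc v = a * v ^ 3 + b * v\<^sup>2 + c * v + d"
    unfolding kern_disc_def a_def b_def c_def d_def by algebra
  hence "b\<^sup>2 * c\<^sup>2 - 4 * a * c ^ 3 - 4 * b ^ 3 * d - 27 * a\<^sup>2 * d\<^sup>2 + 18 * a * b * c * d = 0"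
    using v by (intro discriminant_eq_0[of a v b c d]) (simp_all add: a_def b_def c_def)
  moreover have "b\<^sup>2 * c\<^sup>2 - 4 * a * c ^ 3 - 4 * b ^ 3 * d - 27 * a\<^sup>2 * d\<^sup>2 + 18 * a * b * c * d =
      16 * (1 - fps_X) * (1 - fps_X * avoiders_gf)\<^sup>2 * ?M"
    unfolding a_def b_def c_def d_def by algebra
  \<comment> \<open>The extraneous factors \<open>1 - fps_X\<close> and
    \<open>1 - fps_X * avoiders_gf\<close> have constant term 1, so they can be cancelled.\<close>
  moreover have "1 - fps_X \<noteq> (0 :: rat fps)"
    by (auto dest: arg_cong[of _ _ "\<lambda>f. f $ 0"])
  moreover have "1 - fps_X * avoiders_gf \<noteq> 0"
    by (auto dest: arg_cong[of _ _ "\<lambda>f. f $ 0"])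
  ultimately show ?thesis by simp
qed

section \<open>Irreducibility and minimality\<close>

lemma poly_to_fls_X: "poly_to_fls [:0, 1:] = fls_X"
  by (simp add: poly_to_fls_def fps_of_poly_pCons)

lemma ratfun_to_fls_to_fract: "ratfun_to_fls (to_fract p) = poly_to_fls p"
  by (simp add: to_fract_def ratfun_to_fls_Fract)

lemma ratfun_to_fls_Z [simp]: "ratfun_to_fls Z = fls_X"
  by (simp add: Z_def ratfun_to_fls_to_fract poly_to_fls_X)

lemma ratfun_to_fls_uminus: "ratfun_to_fls (- r) = - ratfun_to_fls r"
  using ratfun_to_fls_add[of r "- r"] by (simp add: eq_neg_iff_add_eq_0 add.commute)

lemma ratfun_to_fls_diff: "ratfun_to_fls (r - s) = ratfun_to_fls r - ratfun_to_fls s"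
  using ratfun_to_fls_add[of r "- s"] by (simp add: ratfun_to_fls_uminus)

lemma ratfun_to_fls_power: "ratfun_to_fls (r ^ n) = ratfun_to_fls r ^ n"
  by (induction n) (simp_all add: ratfun_to_fls_mult)

lemma ratfun_to_fls_of_nat: "ratfun_to_fls (of_nat n) = of_nat n"
  by (induction n) (simp_all add: ratfun_to_fls_add)

lemma ratfun_to_fls_numeral: "ratfun_to_fls (numeral n) = numeral n"
  using ratfun_to_fls_of_nat[of "numeral n"] by simp

lemmas ratfun_to_fls_hom = ratfun_to_fls_add ratfun_to_fls_mult ratfun_to_fls_uminus
  ratfun_to_fls_diff ratfun_to_fls_power ratfun_to_fls_numeral

lemma eval_at_0 [simp]: "eval_at 0 f = 0"
  by (simp add: eval_at_def)

lemma eval_at_pCons: "eval_at (pCons a p) f = ratfun_to_fls a + fps_to_fls f * eval_at p f"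
  by (simp add: eval_at_def map_poly_pCons)

lemma eval_at_add: "eval_at (p + q) f = eval_at p f + eval_at q f"
  by (induction p q rule: poly_induct2) (simp_all add: eval_at_pCons ratfun_to_fls_add algebra_simps)

lemma eval_at_smult: "eval_at (smult c p) f = ratfun_to_fls c * eval_at p f"
  by (induction p) (simp_all add: eval_at_pCons ratfun_to_fls_mult algebra_simps)

lemma eval_at_mult: "eval_at (p * q) f = eval_at p f * eval_at q f"
  by (induction p) (simp_all add: mult_pCons_left eval_at_pCons eval_at_add eval_at_smult algebra_simps)

text \<open>The polynomials vanishing at \<open>f\<close> form an ideal, and a member
  \<open>q\<close> of least degree divides all others. In \<open>p = q * r\<close> one factor is a
  unit by irreducibility; it is not \<open>q\<close>, since that would put 1 into the ideal, so
  \<open>p\<close> has least degree too.\<close>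

lemma irreducible_imp_minimal_poly:
  assumes "irreducible p" "eval_at p f = 0"
  shows "is_minimal_poly p f"
proof -
  define d where "d = (LEAST n. \<exists>q. q \<noteq> 0 \<and> eval_at q f = 0 \<and> degree q = n)"
  have p0: "p \<noteq> 0" using assms(1) by auto
  have "\<exists>q. q \<noteq> 0 \<and> eval_at q f = 0 \<and> degree q = d"
    unfolding d_def by (rule LeastI_ex) (use p0 assms(2) in blast)
  then obtain q where q: "q \<noteq> 0" "eval_at q f = 0" "degree q = d" by blast
  have least: "d \<le> degree r" if "r \<noteq> 0" "eval_at r f = 0" for r
    unfolding d_def using that by (intro Least_le) blast
  have "eval_at (p mod q) f = 0"
    using assms(2) q(2) eval_at_add[of "p div q * q" "p mod q" f] by (simp add: eval_at_mult)
  hence "p mod q = 0"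
    using least[of "p mod q"] degree_mod_less[of q p] q by fastforce
  then obtain r where r: "p = q * r" by (auto simp: mod_eq_0_iff_dvd elim: dvdE)
  have "\<not> is_unit q"
  proof
    assume "is_unit q"
    then obtain s where "1 = q * s" by (elim dvdE)
    hence "eval_at 1 f = 0" using eval_at_mult[of q s f] q(2) by simp
    thus False unfolding one_pCons eval_at_pCons by simp
  qed
  have "is_unit r" using irreducibleD[OF assms(1) r] \<open>\<not> is_unit q\<close> by blast
  moreover have "r \<noteq> 0" using r p0 by auto
  ultimately have "degree r = 0" by (simp add: is_unit_iff_degree)
  hence "degree p = d" using r p0 q(3) by (auto simp: degree_mult_eq)
  thus ?thesis unfolding is_minimal_poly_def using p0 assms(2) least by auto
qed

lemma algebraic_degree_eq:
  assumes "is_minimal_poly p f"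
  shows "algebraic_degree f = degree p"
  unfolding algebraic_degree_def
  by (rule Least_equality) (use assms in \<open>auto simp: is_minimal_poly_def\<close>)

section \<open>Irreducibility over the rational functions\<close>

lemma irreducible_cubic:
  fixes p :: "'a::field poly"
  assumes "degree p = 3" "\<And>x. poly p x \<noteq> 0"
  shows "irreducible p"
proof (rule irreducibleI)
  show p0: "p \<noteq> 0" using assms(1) by auto
  show "\<not> is_unit p" using assms(1) p0 by (simp add: is_unit_iff_degree)
  fix a b assume p: "p = a * b"
  show "is_unit a \<or> is_unit b"
  proof (rule ccontr)
    assume "\<not> (is_unit a \<or> is_unit b)"
    moreover have "a \<noteq> 0" "b \<noteq> 0" using assms(1) p by auto
    ultimately have "degree a \<noteq> 0" "degree b \<noteq> 0"
      by (auto simp: is_unit_iff_degree)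
    moreover have "degree a + degree b = 3"
      using assms(1) \<open>a \<noteq> 0\<close> \<open>b \<noteq> 0\<close> by (simp add: p degree_mult_eq)
    \<comment> \<open>Two positive degrees with sum 3: one factor is linear and has a root.\<close>
    ultimately have "degree a = 1 \<or> degree b = 1" by auto
    then obtain c where c: "degree c = 1" "c dvd p" using p by auto
    obtain k l where "c = [:l, k:]" "k \<noteq> 0"
      by (rule degree1_coeffs[OF c(1)])
    hence "poly c (- l / k) = 0" by simp
    with c(2) assms(2)[of "- l / k"] show False by (auto elim!: dvdE)
  qed
qed

text \<open>Eisenstein's argument at the prime 2 for a root \<open>m / n\<close> in lowest terms:
  \<open>m\<close> is even, and since 4 does not divide 10, \<open>n\<close> is even as
  well.\<close>

lemma cubic_no_rational_root:
  fixes x :: rat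
  shows "x ^ 3 - 16 * x\<^sup>2 - 8 * x + 10 \<noteq> 0"
proof
  assume x: "x ^ 3 - 16 * x\<^sup>2 - 8 * x + 10 = 0"
  obtain m n where mn: "quotient_of x = (m, n)" by (cases "quotient_of x")
  hence "n > 0" "coprime m n" and xmn: "x = of_int m / of_int n"
    by (auto simp: quotient_of_denom_pos quotient_of_coprime quotient_of_div)
  have "(of_int (m ^ 3 - 16 * m\<^sup>2 * n - 8 * m * n\<^sup>2 + 10 * n ^ 3) :: rat) =
      of_int n ^ 3 * (x ^ 3 - 16 * x\<^sup>2 - 8 * x + 10)"
    using \<open>n > 0\<close> unfolding xmn by (simp add: field_simps power2_eq_square power3_eq_cube)
  hence "of_int (m ^ 3 - 16 * m\<^sup>2 * n - 8 * m * n\<^sup>2 + 10 * n ^ 3) = (0 :: rat)"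
    unfolding x by simp
  hence eq: "m ^ 3 - 16 * m\<^sup>2 * n - 8 * m * n\<^sup>2 + 10 * n ^ 3 = 0"
    by (simp only: of_int_eq_0_iff)
  hence "m ^ 3 = 2 * (8 * m\<^sup>2 * n + 4 * m * n\<^sup>2 - 5 * n ^ 3)" by simp
  hence "even (m ^ 3)" by (metis dvd_triv_left)
  hence "even m" by simp
  then obtain k where k: "m = 2 * k" by blast
  have "5 * n ^ 3 = 2 * (16 * k\<^sup>2 * n + 4 * k * n\<^sup>2 - 2 * k ^ 3)"
    using eq unfolding k by (simp add: power_mult_distrib)
  hence "even (5 * n ^ 3)" by (metis dvd_triv_left)
  hence "even n" by simp
  with \<open>even m\<close> have "is_unit (2 :: int)"
    using coprime_common_divisor[OF \<open>coprime m n\<close>] by blast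
  thus False by simp
qed

lemma cubic_form_rat_0:
  fixes a b :: rat
  assumes "a ^ 3 - 16 * a\<^sup>2 * b - 8 * a * b\<^sup>2 + 10 * b ^ 3 = 0"
  shows "a = 0 \<and> b = 0"
proof (cases "b = 0")
  case False
  define x where "x = a / b"
  have a: "a = x * b" using False by (simp add: x_def)
  have "b ^ 3 * (x ^ 3 - 16 * x\<^sup>2 - 8 * x + 10) = 0"
    using assms unfolding a by algebra
  with False cubic_no_rational_root show ?thesis by fastforce
qed (use assms in simp)

text \<open>Infinite descent. At \<open>z = -1\<close> the form becomes that of
  \<open>cubic_form_rat_0\<close>, so \<open>p\<close> and \<open>q\<close> are both divisible by
  \<open>1 + z\<close>. By homogeneity of degree 3 the cofactors solve the same equation, and the
  degree of \<open>q\<close> drops unless \<open>q\<close> is zero.\<close>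

lemma cubic_form_poly_0:
  fixes p q :: "rat poly"
  assumes "[:0, 1:] ^ 4 * p ^ 3 + (5 * [:0, 1:] ^ 3 - 11 * [:0, 1:] ^ 2) * p ^ 2 * q
      + (3 * [:0, 1:] ^ 2 + 10 * [:0, 1:] - 1) * p * q ^ 2 + (- 9 * [:0, 1:] + 1) * q ^ 3 = 0"
  shows "q = 0"
  using assms
proof (induction "degree q" arbitrary: p q rule: less_induct)
  case less
  have "poly p (-1) = 0 \<and> poly q (-1) = 0"
    using arg_cong[OF less.prems, of "\<lambda>p. poly p (-1)"] by (intro cubic_form_rat_0) simp
  then obtain p' q' where pq: "p = [:1, 1:] * p'" "q = [:1, 1:] * q'"
    by (auto simp: poly_eq_0_iff_dvd elim!: dvdE)
  show ?case
  proof (rule ccontr)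
    assume "q \<noteq> 0"
    have "[:1, 1:] ^ 3 * ([:0, 1:] ^ 4 * p' ^ 3 + (5 * [:0, 1:] ^ 3 - 11 * [:0, 1:] ^ 2) * p' ^ 2 * q'
      + (3 * [:0, 1:] ^ 2 + 10 * [:0, 1:] - 1) * p' * q' ^ 2 + (- 9 * [:0, 1:] + 1) * q' ^ 3) = 0"
      using less.prems unfolding pq by algebra
    moreover have "[:1, 1:] ^ 3 \<noteq> (0 :: rat poly)" by simp
    ultimately have "[:0, 1:] ^ 4 * p' ^ 3 + (5 * [:0, 1:] ^ 3 - 11 * [:0, 1:] ^ 2) * p' ^ 2 * q'
      + (3 * [:0, 1:] ^ 2 + 10 * [:0, 1:] - 1) * p' * q' ^ 2 + (- 9 * [:0, 1:] + 1) * q' ^ 3 = 0"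
      by (simp only: mult_eq_0_iff) blast
    moreover have "degree q' < degree q"
      using \<open>q \<noteq> 0\<close> unfolding pq by (subst degree_mult_eq) auto
    ultimately have "q' = 0" using less.hyps by blast
    thus False using \<open>q \<noteq> 0\<close> pq by simp
  qed
qed

lemma to_fract_power: "to_fract (x ^ n) = to_fract x ^ n"
  by (induction n) simp_all

lemma to_fract_of_nat: "to_fract (of_nat n) = of_nat n"
  by (induction n) simp_all

lemma to_fract_numeral: "to_fract (numeral n) = numeral n"
  using to_fract_of_nat[of "numeral n"] by simp

lemma irreducible_min_poly:
  "irreducible [: - 9 * Z + 1, 3 * Z ^ 2 + 10 * Z - 1, 5 * Z ^ 3 - 11 * Z ^ 2, Z ^ 4 :]"
    (is "irreducible ?P")
proof (rule irreducible_cubic)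
  have "Z \<noteq> 0" by (simp add: Z_def)
  thus "degree ?P = 3" by simp
  fix x
  show "poly ?P x \<noteq> 0"
  proof
    assume root: "poly ?P x = 0"
    obtain p q where x: "x = Fract p q" and "q \<noteq> 0" by (cases x)
    define y where "y = to_fract q"
    have "y \<noteq> 0" using \<open>q \<noteq> 0\<close> by (simp add: y_def)
    have xy: "to_fract p = x * y"
      using \<open>y \<noteq> 0\<close> by (simp add: x y_def Fract_conv_to_fract)
    \<comment> \<open>Multiplying the equation for the root \<open>x = p / q\<close> by
      \<open>q ^ 3\<close> clears denominators and gives the homogeneous form in
      polynomials.\<close>
    have "to_fract ([:0, 1:] ^ 4 * p ^ 3 + (5 * [:0, 1:] ^ 3 - 11 * [:0, 1:] ^ 2) * p ^ 2 * q
      + (3 * [:0, 1:] ^ 2 + 10 * [:0, 1:] - 1) * p * q ^ 2 + (- 9 * [:0, 1:] + 1) * q ^ 3) =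
      Z ^ 4 * (x * y) ^ 3 + (5 * Z ^ 3 - 11 * Z ^ 2) * (x * y) ^ 2 * y
      + (3 * Z ^ 2 + 10 * Z - 1) * (x * y) * y ^ 2 + (- 9 * Z + 1) * y ^ 3"
      by (simp only: to_fract_add to_fract_diff to_fract_mult to_fract_uminus to_fract_power
        to_fract_numeral to_fract_1 Z_def[symmetric] y_def[symmetric] xy)
    also have "\<dots> = y ^ 3 * poly ?P x"
      by (simp add: algebra_simps power2_eq_square power3_eq_cube power4_eq_xxxx)
    also have "\<dots> = 0" by (simp only: root mult_zero_right)
    finally have "q = 0"
      by (intro cubic_form_poly_0[of p q]) (simp only: to_fract_eq_0_iff)
    with \<open>q \<noteq> 0\<close> show False by simp
  qed
qed

lemma eval_at_min_poly:
  "eval_at [: - 9 * Z + 1, 3 * Z ^ 2 + 10 * Z - 1, 5 * Z ^ 3 - 11 * Z ^ 2, Z ^ 4 :] f =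
    fps_to_fls (fps_X ^ 4 * f ^ 3 + (5 * fps_X ^ 3 - 11 * fps_X ^ 2) * f ^ 2
      + (3 * fps_X ^ 2 + 10 * fps_X - 1) * f - 9 * fps_X + 1)"
  by (simp add: eval_at_pCons ratfun_to_fls_hom fls_times_fps_to_fls fps_to_fls_power
      algebra_simps power2_eq_square power3_eq_cube power4_eq_xxxx)

theorem mainTheorem1:
  fixes F :: "rat fps" and P :: "rat poly fract poly"
  defines "F \<equiv> class_gf (Av {[2,4,1,3], [3,4,1,2]})"
    and "P \<equiv> [: - 9 * Z + 1, 3 * Z ^ 2 + 10 * Z - 1, 5 * Z ^ 3 - 11 * Z ^ 2, Z ^ 4 :]"
  shows "algebraic_fps F \<and> algebraic_degree F = 3 \<and> is_minimal_poly P F \<and>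
    fps_X ^ 4 * F ^ 3 + (5 * fps_X ^ 3 - 11 * fps_X ^ 2) * F ^ 2
      + (3 * fps_X ^ 2 + 10 * fps_X - 1) * F - 9 * fps_X + 1 = 0 \<and>
    irreducible P"
proof -
  have F: "F = avoiders_gf"
    unfolding F_def avoiders_def[symmetric] by (rule class_gf_avoiders)
  have root: "eval_at P F = 0"
    unfolding P_def F eval_at_min_poly avoiders_gf_cubic by simp
  have irr: "irreducible P"
    unfolding P_def by (rule irreducible_min_poly)
  have min: "is_minimal_poly P F"
    using irr root by (rule irreducible_imp_minimal_poly)
  have "Z \<noteq> 0" by (simp add: Z_def)
  hence "degree P = 3" by (simp add: P_def)
  hence "algebraic_degree F = 3"
    using algebraic_degree_eq[OF min] by simp
  moreover have "algebraic_fps F"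
    using min by (auto simp: algebraic_fps_def is_minimal_poly_def)
  ultimately show ?thesis
    using irr min avoiders_gf_cubic unfolding F by blast
qed

end
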